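(* Let $p\ge1$ be an integer, let $\mu_0,\ldots,\mu_p$ be Borel probability measures with compact support in $\mathbb{C}$, and let $(a_n^{(k)})_{n\in\mathbb{Z}}$, $0\le k\le p$, be $p+1$ sequences of complex random variables such that: (a1) for each $0\le k\le p$ the sequence $(a_n^{(k)})_{n\in\mathbb{Z}}$ is i.i.d. with distribution $\mu_k$; (a2) the collection $\{a_n^{(k)}:n\in\mathbb{Z},\,0\le k\le p\}$ is jointly independent; (a3) there is a constant $C>0$ such that $|a_n^{(k)}|\le C$ surely for all $k$ and $n$. Let $\mathcal{M}$ be the two-sided operator on $\ell^2(\mathbb{Z})$ associated with these sequences, with matrix $M=(m_{i,j})_{i,j\in\mathbb{Z}}$, and let $W(z)=\langle(zI-\mathcal{M})^{-1}\hat e_0,\hat e_0\rangle$. Let $M_n$ be the $n\times n$ submatrix of $M$ with entries $m_{i,j}$, $-\lfloor (n-1)/2\rfloor\le i,j\le\lceil (n-1)/2\rceil$, with eigenvalues $\{\lambda_{k,n}\}_{k=1}^n$ (counting multiplicities), and let $Q_n(z)=\det(zI_n-M_n)$. Then for each integer $s\ge0$, $$\lim_{n\to\infty}\frac1n\,\mathbb{E}\left(\sum_{k=1}^n\lambda_{k,n}^s\right)=\mathbb{E}([W]_{s+1}).$$ Moreover, there exists $R>0$ such that for all $|z|>R$, $$\lim_{n\to\infty}\frac1n\,\mathbb{E}\left(\frac{Q_n'(z)}{Q_n(z)}\right)=\mathbb{E}(W(z)).$$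
   Context: $\{\hat e_n\}_{n\in\mathbb{Z}}$ is the standard orthonormal basis of $\ell^2(\mathbb{Z})$ and $\mathcal{M}$ is the bounded operator with $\mathcal{M}\hat e_n=\hat e_{n-1}+\sum_{k=0}^p a_n^{(k)}\hat e_{n+k}$, $n\in\mathbb{Z}$. Its matrix $M=(m_{i,j})_{i,j\in\mathbb{Z}}$ has entries $m_{j-1,j}=1$ for $j\in\mathbb{Z}$; $m_{j+k,j}=a_j^{(k)}$ for $0\le k\le p$, $j\in\mathbb{Z}$; and $m_{i,j}=0$ otherwise. For a Laurent series $f(z)=\sum_{k\in\mathbb{Z}}c_kz^{-k}$ write $[f]_k=c_k$; $[W]_k$ refers to the Laurent expansion of $W$ at infinity (valid for $|z|>\|\mathcal{M}\|$). *)

theory Defs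
  imports
    "HOL-Probability.Probability"
    "HOL-Complex_Analysis.Complex_Analysis"
    "Jordan_Normal_Form.Char_Poly"
begin

hide_const (open) Determinants.det Finite_Cartesian_Product.vec Finite_Cartesian_Product.mat

section \<open>The Hilbert space of square summable two-sided sequences\<close>

definition l2 :: "(int \<Rightarrow> complex) set" where
  "l2 = {x. (\<lambda>n. (cmod (x n))\<^sup>2) summable_on UNIV}"

definition l2_inner :: "(int \<Rightarrow> complex) \<Rightarrow> (int \<Rightarrow> complex) \<Rightarrow> complex" where
  "l2_inner x y = (\<Sum>\<^sub>\<infinity>n. x n * cnj (y n))"

definition l2_basis :: "int \<Rightarrow> int \<Rightarrow> complex" where
  "l2_basis n = (\<lambda>i. if i = n then 1 else 0)"


section \<open>The two-sided band operator and its resolvent function\<close>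

text \<open>The argument \<open>a k j\<close> is the coefficient with upper index \<open>k\<close> and lower index \<open>j\<close>.\<close>

definition band_entry :: "nat \<Rightarrow> (nat \<Rightarrow> int \<Rightarrow> complex) \<Rightarrow> int \<Rightarrow> int \<Rightarrow> complex" where
  "band_entry p a i j =
     (if i = j - 1 then 1
      else if j \<le> i \<and> i \<le> j + int p then a (nat (i - j)) j
      else 0)"

text \<open>Every row of the matrix has at most \<open>p + 2\<close> nonzero entries, so the sum below is
  finite for every sequence \<open>x\<close>.\<close>

definition band_op :: "nat \<Rightarrow> (nat \<Rightarrow> int \<Rightarrow> complex) \<Rightarrow> (int \<Rightarrow> complex) \<Rightarrow> (int \<Rightarrow> complex)" where
  "band_op p a x = (\<lambda>i. \<Sum>\<^sub>\<infinity>j. band_entry p a i j * x j)"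

lemma band_op_eq:
  "band_op p a x i = x (i + 1) + (\<Sum>k\<le>p. a k (i - int k) * x (i - int k))"
proof -
  have "band_op p a x i = (\<Sum>\<^sub>\<infinity>j\<in>{i - int p..i + 1}. band_entry p a i j * x j)"
    unfolding band_op_def by (rule infsum_cong_neutral) (auto simp: band_entry_def)
  also have "\<dots> = (\<Sum>j\<in>{i - int p..i + 1}. band_entry p a i j * x j)"
    by simp
  also have "{i - int p..i + 1} = insert (i + 1) {i - int p..i}"
    by auto
  also have "(\<Sum>j\<in>\<dots>. band_entry p a i j * x j)
      = x (i + 1) + (\<Sum>j\<in>{i - int p..i}. a (nat (i - j)) j * x j)"
    by (simp add: band_entry_def)
  also have "(\<Sum>j\<in>{i - int p..i}. a (nat (i - j)) j * x j)
      = (\<Sum>k\<le>p. a k (i - int k) * x (i - int k))"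
    by (rule sum.reindex_bij_witness[where i = "\<lambda>k. i - int k" and j = "\<lambda>j. nat (i - j)"]) auto
  finally show ?thesis .
qed

lemma band_op_basis:
  "band_op p a (l2_basis n) =
     (\<lambda>i. l2_basis (n - 1) i + (\<Sum>k\<le>p. a k n * l2_basis (n + int k) i))"
proof
  fix i
  have "(\<Sum>k\<le>p. a k (i - int k) * l2_basis n (i - int k))
      = (\<Sum>k\<le>p. a k n * l2_basis (n + int k) i)"
    by (rule sum.cong) (auto simp: l2_basis_def)
  thus "band_op p a (l2_basis n) i
      = l2_basis (n - 1) i + (\<Sum>k\<le>p. a k n * l2_basis (n + int k) i)"
    unfolding band_op_eq by (auto simp: l2_basis_def)
qed

definition shifted_op ::
    "nat \<Rightarrow> (nat \<Rightarrow> int \<Rightarrow> complex) \<Rightarrow> complex \<Rightarrow> (int \<Rightarrow> complex) \<Rightarrow> (int \<Rightarrow> complex)" where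
  "shifted_op p a z x = (\<lambda>i. z * x i - band_op p a x i)"

definition resolvent_fun :: "nat \<Rightarrow> (nat \<Rightarrow> int \<Rightarrow> complex) \<Rightarrow> complex \<Rightarrow> complex" where
  "resolvent_fun p a z =
     l2_inner (inv_into l2 (shifted_op p a z) (l2_basis 0)) (l2_basis 0)"


section \<open>Laurent coefficients at infinity\<close>

text \<open>The coefficient with index \<open>k\<close> belongs to the power with exponent \<open>-k\<close>.\<close>

definition is_laurent_at_infinity :: "(complex \<Rightarrow> complex) \<Rightarrow> (int \<Rightarrow> complex) \<Rightarrow> bool" where
  "is_laurent_at_infinity f c \<longleftrightarrow>
     (\<exists>R>0. \<forall>z. cmod z > R \<longrightarrow> ((\<lambda>k. c k * z powi (- k)) has_sum f z) UNIV)"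

definition laurent_coeff :: "(complex \<Rightarrow> complex) \<Rightarrow> int \<Rightarrow> complex" where
  "laurent_coeff f = (THE c. is_laurent_at_infinity f c)"

lemma has_integral_cis_int:
  fixes m :: int
  shows "((\<lambda>t. cis (of_int m * t)) has_integral (if m = 0 then 2 * pi else 0)) {0..2 * pi}"
proof (cases "m = 0")
  case True
  have "((\<lambda>t::real. 1 :: complex) has_integral (2 * pi - 0) *\<^sub>R 1) {0..2 * pi}"
    using has_integral_const_real[of "1::complex" 0 "2 * pi"] by simp
  thus ?thesis using True by (simp add: scaleR_conv_of_real)
next
  case False
  let ?F = "\<lambda>t::real. cis (of_int m * t) / (\<i> * of_int m)"
  have "((\<lambda>t. cis (of_int m * t)) has_integral (?F (2 * pi) - ?F 0)) {0..2 * pi}"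
  proof (rule fundamental_theorem_of_calculus)
    fix t :: real
    have "((\<lambda>w. exp (\<i> * of_int m * w) / (\<i> * of_int m)) has_field_derivative
            exp (\<i> * of_int m * of_real t)) (at (of_real t))"
      using False by (auto intro!: derivative_eq_intros)
    from has_vector_derivative_real_field[OF this]
    show "(?F has_vector_derivative cis (of_int m * t)) (at t within {0..2 * pi})"
      by (simp add: cis_conv_exp mult_ac)
  qed auto
  moreover have "cis (of_int m * (2 * pi)) = 1"
    by (metis cis_multiple_2pi Ints_of_int mult.commute mult.left_commute)
  ultimately show ?thesis using False by simp
qed

lemma laurent_at_infinity_unique:
  assumes "is_laurent_at_infinity f c" "is_laurent_at_infinity f d"
  shows "c = d"
proof
  fix m :: int
  define e where "e k = c k - d k" for k
  obtain R1 R2 where R: "R1 > 0" "R2 > 0"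
    and c: "\<And>z. cmod z > R1 \<Longrightarrow> ((\<lambda>k. c k * z powi (- k)) has_sum f z) UNIV"
    and d: "\<And>z. cmod z > R2 \<Longrightarrow> ((\<lambda>k. d k * z powi (- k)) has_sum f z) UNIV"
    using assms unfolding is_laurent_at_infinity_def by blast
  define r where "r = R1 + R2"
  have r: "r > 0" using R by (simp add: r_def)
  have e: "((\<lambda>k. e k * (of_real r * cis t) powi (- k)) has_sum 0) UNIV" for t
  proof -
    have "cmod (of_real r * cis t) = r" using r by (simp add: norm_mult)
    hence "((\<lambda>k. c k * (of_real r * cis t) powi (- k) - d k * (of_real r * cis t) powi (- k))
        has_sum (f (of_real r * cis t) - f (of_real r * cis t))) UNIV"
      using has_sum_add[OF c[of "of_real r * cis t"] has_sum_uminusI[OF d[of "of_real r * cis t"]]] R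
      by (simp add: r_def)
    thus ?thesis by (simp add: e_def algebra_simps)
  qed
  define g where "g k t = e k * of_real (r powi (- k)) * cis (of_int (m - k) * t)" for k t
  have g: "((\<lambda>k. g k t) has_sum 0) UNIV" for t
  proof -
    have "((\<lambda>k. cis (of_int m * t) * (e k * (of_real r * cis t) powi (- k)))
        has_sum cis (of_int m * t) * 0) UNIV"
      by (rule has_sum_cmult_right[OF e])
    moreover have "cis (of_int m * t) * (e k * (of_real r * cis t) powi (- k)) = g k t" for k
    proof -
      have "(of_real r * cis t) powi (- k) = of_real (r powi (- k)) * cis (- of_int k * t)"
        by (simp add: power_int_mult_distrib cis_power_int)
      moreover have "cis (of_int (m - k) * t) = cis (of_int m * t) * cis (- of_int k * t)"
        by (simp add: cis_mult algebra_simps)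
      ultimately show ?thesis by (simp add: g_def)
    qed
    ultimately show ?thesis by simp
  qed
  have "(\<lambda>k. g k 0) summable_on UNIV"
    using g by (rule has_sum_imp_summable)
  hence "(\<lambda>k. norm (g k 0)) summable_on UNIV"
    by (simp add: summable_on_iff_abs_summable_on_complex)
  hence "uniform_limit {0..2 * pi} (\<lambda>F t. \<Sum>k\<in>F. g k t) (\<lambda>t. \<Sum>\<^sub>\<infinity>k. g k t)
      (finite_subsets_at_top UNIV)"
    by (intro Weierstrass_m_test_general) (auto simp: g_def norm_mult)
  hence lim: "uniform_limit {0..2 * pi} (\<lambda>F t. \<Sum>k\<in>F. g k t) (\<lambda>t. 0)
      (finite_subsets_at_top UNIV)"
    using infsumI[OF g] by simp
  have int_g: "(g k has_integral (if k = m then e m * of_real (r powi (- m)) * (2 * pi) else 0))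
      {0..2 * pi}" for k
    using has_integral_mult_right[OF has_integral_cis_int[of "m - k"], of "e k * of_real (r powi (- k))"]
    unfolding g_def by (cases "k = m") auto
  have cont: "continuous_on {0..2 * pi} (\<lambda>t. \<Sum>k\<in>F. g k t)" for F
    unfolding g_def cis_conv_exp by (intro continuous_intros)
  obtain I J where I: "\<And>F. ((\<lambda>t. \<Sum>k\<in>F. g k t) has_integral I F) {0..2 * pi}"
    and J: "((\<lambda>t. 0) has_integral J) {0..2 * pi}"
    and IJ: "(I \<longlongrightarrow> J) (finite_subsets_at_top UNIV)"
    by (rule uniform_limit_integral[OF lim cont]) auto
  have "J = 0" using J has_integral_0 has_integral_unique by blast
  have ev: "\<forall>\<^sub>F F in finite_subsets_at_top UNIV. I F = e m * of_real (r powi (- m)) * (2 * pi)"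
  proof -
    have "I F = e m * of_real (r powi (- m)) * (2 * pi)" if F: "finite F" "m \<in> F" for F
    proof -
    have "((\<lambda>t. \<Sum>k\<in>F. g k t) has_integral
       (\<Sum>k\<in>F. if k = m then e m * of_real (r powi (- m)) * (2 * pi) else 0)) {0..2 * pi}"
      by (rule has_integral_sum[OF F(1)]) (rule int_g)
    hence "I F = (\<Sum>k\<in>F. if k = m then e m * of_real (r powi (- m)) * (2 * pi) else 0)"
      using I has_integral_unique by blast
    also have "\<dots> = e m * of_real (r powi (- m)) * (2 * pi)" using F by simp
    finally show ?thesis .
    qed
    thus ?thesis
      unfolding eventually_finite_subsets_at_top by (intro exI[of _ "{m}"]) auto
  qed
  have "e m * of_real (r powi (- m)) * (2 * pi) = 0"
    using tendsto_unique[OF _ tendsto_eventually[OF ev] IJ] \<open>J = 0\<close> by simp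
  thus "c m = d m" using r by (simp add: e_def)
qed

lemma laurent_coeff_eqI:
  assumes "is_laurent_at_infinity f c"
  shows "laurent_coeff f = c"
  unfolding laurent_coeff_def
  using assms laurent_at_infinity_unique by blast


section \<open>Finite truncations\<close>

text \<open>Matrices are indexed from \<open>0\<close>: position \<open>(i, j)\<close> holds the entry whose row and column
  indices are translated by the lower end of the index window.\<close>

definition window_start :: "nat \<Rightarrow> int" where
  "window_start n = - \<lfloor>(real n - 1) / 2\<rfloor>"

lemma window:
  "(\<lambda>i. window_start n + int i) ` {..<n} = {- \<lfloor>(real n - 1) / 2\<rfloor>..\<lceil>(real n - 1) / 2\<rceil>}"
proof -
  have "\<lfloor>(real n - 1) / 2\<rfloor> + \<lceil>(real n - 1) / 2\<rceil> = int n - 1"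
  proof (cases "even n")
    case True
    then obtain k where k: "n = 2 * k" by blast
    have "\<lfloor>(real n - 1) / 2\<rfloor> = int k - 1"
      unfolding k floor_eq_iff by simp
    moreover have "\<lceil>(real n - 1) / 2\<rceil> = int k"
      unfolding k ceiling_eq_iff by simp
    ultimately show ?thesis by (simp add: k)
  next
    case False
    then obtain k where k: "n = 2 * k + 1" by (auto elim: oddE)
    show ?thesis unfolding k by simp
  qed
  hence eq: "\<lceil>(real n - 1) / 2\<rceil> = window_start n + int n - 1" by (simp add: window_start_def)
  show ?thesis unfolding eq window_start_def[symmetric]
  proof (intro equalityI subsetI)
    fix x assume "x \<in> {window_start n..window_start n + int n - 1}"
    thus "x \<in> (\<lambda>i. window_start n + int i) ` {..<n}"
      by (intro image_eqI[of _ _ "nat (x - window_start n)"]) auto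
  qed auto
qed

definition band_trunc :: "nat \<Rightarrow> (nat \<Rightarrow> int \<Rightarrow> complex) \<Rightarrow> nat \<Rightarrow> complex mat" where
  "band_trunc p a n =
     mat n n (\<lambda>(i, j). band_entry p a (window_start n + int i) (window_start n + int j))"

definition eigenvalues_mset :: "complex mat \<Rightarrow> complex multiset" where
  "eigenvalues_mset A = proots (char_poly A)"

definition band_char :: "nat \<Rightarrow> (nat \<Rightarrow> int \<Rightarrow> complex) \<Rightarrow> nat \<Rightarrow> complex \<Rightarrow> complex" where
  "band_char p a n z = Determinant.det (z \<cdot>\<^sub>m 1\<^sub>m n - band_trunc p a n)"


section \<open>Support of a Borel measure\<close>

definition msupport :: "complex measure \<Rightarrow> complex set" where
  "msupport \<mu> = {x. \<forall>U. open U \<and> x \<in> U \<longrightarrow> emeasure \<mu> U > 0}"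

end

theory Submission
  imports Defs "Jordan_Normal_Form.Schur_Decomposition"
begin

text \<open>
  Both limits rest on one comparison of matrix powers. Write \<open>T\<close> for the band operator and \<open>A\<close> for its
  truncation to a window of length \<open>n\<close>.

  On the side of the operator, the resolvent is the Neumann series
  \<open>\<Sum>s. T ^^ s / z ^ (s + 1)\<close> for \<open>|z| > B\<close>, where \<open>B\<close> bounds the absolute row sums. Hence the Laurent
  coefficient of the resolvent function with index \<open>s + 1\<close> is the diagonal entry of \<open>T ^^ s\<close> at \<open>0\<close>
  (\<open>laurent_coeff_resolvent\<close>). The inverse is taken on all of \<open>l2\<close>, so the series is shown to preserve
  \<open>l2\<close>, and uniqueness follows from the growth of the iterates (\<open>shifted_op_bij\<close>).

  On the side of the truncation, the sum of the \<open>s\<close>-th powers of the eigenvalues is the trace of the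
  \<open>s\<close>-th power of \<open>A\<close> (\<open>eigenvalue_power_sum_eq_trace\<close>). The band structure means that the
  diagonal entries of the powers of \<open>A\<close> and of \<open>T\<close> agree except at no more than \<open>s + p * s\<close> places near the
  boundary, whatever \<open>n\<close> is (\<open>mat_trace_band_trunc_approx\<close>).

  The randomness of the coefficients enters through stationarity: the joint law is invariant under
  translation, so all diagonal entries of \<open>T ^^ s\<close> have the same expectation, and the normalised
  expected trace differs from it by \<open>O(1 / n)\<close> (\<open>expected_trace_limit\<close>). This is the statement on
  moments. The statement on the logarithmic derivative follows by summation: for \<open>|z| > B\<close> it is
  the series of the traces over powers of \<open>z\<close> (\<open>log_deriv_char_poly_sums\<close>), and a geometric
  majorant independent of \<open>n\<close> and of the coefficients permits the exchange of expectation, limit and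
  summation.
\<close>

section \<open>Eigenvalues and traces of matrix powers\<close>

definition mat_trace :: "'a :: comm_monoid_add mat \<Rightarrow> 'a" where
  "mat_trace A = (\<Sum>i<dim_row A. A $$ (i, i))"

lemma mat_mult_entry:
  assumes "A \<in> carrier_mat n m" "B \<in> carrier_mat m r" "i < n" "j < r"
  shows "(A * B) $$ (i, j) = (\<Sum>k<m. A $$ (i, k) * B $$ (k, j))"
  using assms by (auto simp: scalar_prod_def atLeast0LessThan intro!: sum.cong)

lemma mat_trace_mult_commute:
  fixes A B :: "'a :: comm_semiring_0 mat"
  assumes A: "A \<in> carrier_mat n n" and B: "B \<in> carrier_mat n n"
  shows "mat_trace (A * B) = mat_trace (B * A)"
proof -
  have "mat_trace (A * B) = (\<Sum>i<n. \<Sum>k<n. A $$ (i, k) * B $$ (k, i))"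
    unfolding mat_trace_def using A B
    by (intro sum.cong) (auto simp del: index_mult_mat(1) simp: mat_mult_entry[OF A B])
  also have "\<dots> = (\<Sum>k<n. \<Sum>i<n. B $$ (k, i) * A $$ (i, k))"
    by (subst sum.swap) (simp add: mult.commute)
  also have "\<dots> = mat_trace (B * A)"
    unfolding mat_trace_def using A B
    by (intro sum.cong) (auto simp del: index_mult_mat(1) simp: mat_mult_entry[OF B A])
  finally show ?thesis .
qed

text \<open>Both assertions are proved in one induction: in the product of a power with \<open>B\<close>, every
  summand that pairs a position below the diagonal with anything else vanishes, so on the diagonal only
  the product of the two diagonal entries survives.
\<close>

lemma upper_triangular_pow:
  fixes B :: "'a :: comm_ring_1 mat"
  assumes B: "B \<in> carrier_mat n n" and ut: "upper_triangular B"
  shows "(\<forall>i<n. \<forall>j<i. (B ^\<^sub>m s) $$ (i, j) = 0) \<and> (\<forall>i<n. (B ^\<^sub>m s) $$ (i, i) = (B $$ (i, i)) ^ s)"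
proof (induction s)
  case 0
  show ?case using B by auto
next
  case (Suc s)
  have Bs: "B ^\<^sub>m s \<in> carrier_mat n n" using B by simp
  have ut': "B $$ (i, j) = 0" if "i < n" "j < i" for i j
    using ut B that by auto
  have "(B ^\<^sub>m Suc s) $$ (i, j) = 0" if ij: "i < n" "j < i" for i j
  proof -
    have "(B ^\<^sub>m s) $$ (i, k) * B $$ (k, j) = 0" if "k < n" for k
      using Suc ut'[of k j] ij that by (cases "k < i") auto
    thus ?thesis using ij by (simp add: mat_mult_entry[OF Bs B])
  qed
  moreover have "(B ^\<^sub>m Suc s) $$ (i, i) = (B $$ (i, i)) ^ Suc s" if i: "i < n" for i
  proof -
    have "(B ^\<^sub>m s) $$ (i, k) * B $$ (k, i) = (if k = i then B $$ (i, i) ^ Suc s else 0)" if "k < n" for k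
      using Suc ut'[of k i] i that by (cases k i rule: linorder_cases) auto
    hence "(B ^\<^sub>m Suc s) $$ (i, i) = (\<Sum>k<n. if k = i then B $$ (i, i) ^ Suc s else 0)"
      using i by (simp add: mat_mult_entry[OF Bs B])
    thus ?thesis using i by simp
  qed
  ultimately show ?case by blast
qed

lemma proots_prod_linear:
  fixes es :: "complex list"
  assumes "q = (\<Prod>e\<leftarrow>es. [:- e, 1:])"
  shows "proots q = mset es"
proof -
  have "proots (\<Prod>e\<leftarrow>es. [:- e, 1:]) = mset es"
  proof (induction es)
    case (Cons e es)
    have "(\<Prod>e\<leftarrow>es. [:- e, 1:]) \<noteq> 0"
      by (subst prod_list_zero_iff) auto
    hence "proots ([:- e, 1:] * (\<Prod>e\<leftarrow>es. [:- e, 1:])) = proots [:- e, 1:] + mset es"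
      by (subst proots_mult) (auto simp: Cons.IH)
    thus ?case by simp
  qed simp
  thus ?thesis using assms by simp
qed

text \<open>In a Schur decomposition the triangular factor carries the eigenvalues on its diagonal, so the
  diagonal of its \<open>s\<close>-th power consists of their \<open>s\<close>-th powers; the trace does not see the change of
  basis. This identity is what replaces eigenvalues by matrix entries, which are local and
  measurable functions of the coefficients.
\<close>

lemma eigenvalue_power_sum_eq_trace:
  assumes A: "A \<in> carrier_mat n n"
  shows "(\<Sum>\<nu>\<in>#eigenvalues_mset A. \<nu> ^ s) = mat_trace (A ^\<^sub>m s)"
proof -
  obtain es where es: "char_poly A = (\<Prod>e\<leftarrow>es. [:- e, 1:])" "length es = n"
    using char_poly_factorized[OF A] by blast
  obtain B P Q where schur: "schur_decomposition A es = (B, P, Q)"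
    by (metis prod_cases3)
  from schur_decomposition[OF A es(1) schur]
  have wit: "similar_mat_wit A B P Q" and ut: "upper_triangular B" and diag: "diag_mat B = es"
    by auto
  from similar_mat_witD2[OF A wit] have carr: "B \<in> carrier_mat n n" "P \<in> carrier_mat n n" "Q \<in> carrier_mat n n"
    and QP: "Q * P = 1\<^sub>m n" by auto
  have Bs: "B ^\<^sub>m s \<in> carrier_mat n n" using carr by simp
  have "mat_trace (A ^\<^sub>m s) = mat_trace ((P * B ^\<^sub>m s) * Q)"
    using similar_mat_wit_pow_id[OF wit] by simp
  also have "\<dots> = mat_trace (Q * (P * B ^\<^sub>m s))"
    by (rule mat_trace_mult_commute) (use carr Bs in auto)
  also have "Q * (P * B ^\<^sub>m s) = B ^\<^sub>m s"
    using carr Bs QP by (simp flip: assoc_mult_mat[of Q n n P n "B ^\<^sub>m s" n])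
  also have "mat_trace (B ^\<^sub>m s) = (\<Sum>i<n. (B $$ (i, i)) ^ s)"
    using upper_triangular_pow[OF carr(1) ut, of s] carr(1) by (auto simp: mat_trace_def)
  also have "\<dots> = (\<Sum>e\<leftarrow>es. e ^ s)"
    unfolding diag[symmetric] diag_mat_def using carr
    by (simp add: o_def interv_sum_list_conv_sum_set_nat atLeast0LessThan)
  also have "\<dots> = (\<Sum>\<nu>\<in>#mset es. \<nu> ^ s)"
    by (metis mset_map sum_mset_sum_list)
  also have "mset es = eigenvalues_mset A"
    unfolding eigenvalues_mset_def by (rule proots_prod_linear[OF es(1), symmetric])
  finally show ?thesis ..
qed

text \<open>At a coordinate where an eigenvector has maximal modulus, the eigenvalue equation bounds
  \<open>|\<nu>|\<close> by the absolute sum of that row.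
\<close>

lemma eigenvalue_le_row_sum:
  fixes A :: "complex mat"
  assumes A: "A \<in> carrier_mat n n" and \<nu>: "\<nu> \<in># eigenvalues_mset A"
    and row: "\<And>i. i < n \<Longrightarrow> (\<Sum>j<n. cmod (A $$ (i, j))) \<le> r"
  shows "cmod \<nu> \<le> r"
proof -
  have "poly (char_poly A) \<nu> = 0"
    using \<nu> unfolding eigenvalues_mset_def by (cases "char_poly A = 0") auto
  then obtain v where v: "v \<in> carrier_vec n" "v \<noteq> 0\<^sub>v n" "A *\<^sub>v v = \<nu> \<cdot>\<^sub>v v"
    using eigenvalue_root_char_poly[OF A] A unfolding eigenvalue_def eigenvector_def by auto
  define N where "N = Max ((\<lambda>i. cmod (v $ i)) ` {..<n})"
  obtain i0 where i0: "i0 < n" "v $ i0 \<noteq> 0"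
    using v(1,2) by (metis carrier_vecD eq_vecI index_zero_vec)
  have le: "cmod (v $ i) \<le> N" if "i < n" for i
    unfolding N_def using that by (intro Max_ge) auto
  obtain i where i: "i < n" "cmod (v $ i) = N"
  proof -
    have "N \<in> (\<lambda>i. cmod (v $ i)) ` {..<n}"
      unfolding N_def using i0 by (intro Max_in) auto
    thus ?thesis using that by auto
  qed
  have N: "N > 0" using le[OF i0(1)] i0(2) by (metis less_le_trans zero_less_norm_iff)
  have "\<nu> * v $ i = (A *\<^sub>v v) $ i" using v i by simp
  also have "\<dots> = (\<Sum>j<n. A $$ (i, j) * v $ j)"
    using v(1) A i by (auto simp: scalar_prod_def atLeast0LessThan intro!: sum.cong)
  finally have "cmod \<nu> * N = cmod (\<Sum>j<n. A $$ (i, j) * v $ j)"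
    using i(2) by (metis norm_mult)
  also have "\<dots> \<le> (\<Sum>j<n. cmod (A $$ (i, j)) * N)"
    by (rule sum_norm_le) (auto simp: norm_mult intro!: mult_left_mono le)
  also have "\<dots> \<le> r * N"
    using row[OF i(1)] N by (simp add: mult_right_mono flip: sum_distrib_right)
  finally show ?thesis using N by simp
qed

text \<open>The largest absolute row sum is the operator norm for the supremum norm, hence
  submultiplicative.
\<close>

lemma pow_mat_entry_le:
  fixes A :: "complex mat"
  assumes A: "A \<in> carrier_mat n n"
    and row: "\<And>i. i < n \<Longrightarrow> (\<Sum>j<n. cmod (A $$ (i, j))) \<le> r" and r: "0 \<le> r"
    and i: "i < n" "j < n"
  shows "cmod ((A ^\<^sub>m s) $$ (i, j)) \<le> r ^ s"
proof -
  have "(\<Sum>j<n. cmod ((A ^\<^sub>m s) $$ (i, j))) \<le> r ^ s" if "i < n" for i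
  proof (induction s)
    case 0
    have "(\<Sum>j<n. cmod (1\<^sub>m n $$ (i, j))) = (\<Sum>j<n. if j = i then 1 else 0)"
      using that by (intro sum.cong) auto
    thus ?case using that A by simp
  next
    case (Suc s)
    have As: "A ^\<^sub>m s \<in> carrier_mat n n" using A by simp
    have "(\<Sum>j<n. cmod ((A ^\<^sub>m Suc s) $$ (i, j)))
        \<le> (\<Sum>j<n. \<Sum>k<n. cmod ((A ^\<^sub>m s) $$ (i, k)) * cmod (A $$ (k, j)))"
      using that by (intro sum_mono)
        (auto simp: mat_mult_entry[OF As A] norm_mult intro!: sum_norm_le)
    also have "\<dots> = (\<Sum>k<n. cmod ((A ^\<^sub>m s) $$ (i, k)) * (\<Sum>j<n. cmod (A $$ (k, j))))"
      by (subst sum.swap) (simp add: sum_distrib_left)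
    also have "\<dots> \<le> (\<Sum>k<n. cmod ((A ^\<^sub>m s) $$ (i, k)) * r)"
      using row by (intro sum_mono mult_left_mono) auto
    also have "\<dots> \<le> r ^ Suc s"
      using mult_right_mono[OF Suc r] by (simp add: mult.commute sum_distrib_left)
    finally show ?case .
  qed
  from this[OF i(1)] show ?thesis
    using member_le_sum[of j "{..<n}" "\<lambda>j. cmod ((A ^\<^sub>m s) $$ (i, j))"] i by force
qed

lemma log_deriv_prod_linear:
  fixes z :: complex
  assumes "z \<notin> set es"
  shows "poly (\<Prod>e\<leftarrow>es. [:- e, 1:]) z \<noteq> 0 \<and>
    poly (pderiv (\<Prod>e\<leftarrow>es. [:- e, 1:])) z / poly (\<Prod>e\<leftarrow>es. [:- e, 1:]) z = (\<Sum>e\<leftarrow>es. 1 / (z - e))"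
  using assms
proof (induction es)
  case (Cons e es)
  let ?q = "\<Prod>e\<leftarrow>es. [:- e, 1:]"
  from Cons have q: "poly ?q z \<noteq> 0" and IH: "poly (pderiv ?q) z / poly ?q z = (\<Sum>e\<leftarrow>es. 1 / (z - e))"
    and ze: "z - e \<noteq> 0" by auto
  have "poly (pderiv ([:- e, 1:] * ?q)) z / poly ([:- e, 1:] * ?q) z
      = ((z - e) * poly (pderiv ?q) z + poly ?q z) / ((z - e) * poly ?q z)"
    by (simp only: pderiv_mult) (simp add: pderiv_pCons algebra_simps)
  also have "\<dots> = poly (pderiv ?q) z / poly ?q z + 1 / (z - e)"
    using q ze by (simp add: field_simps)
  finally show ?case using q ze IH by simp
qed simp

lemma char_poly_eval:
  fixes A :: "complex mat"
  assumes A: "A \<in> carrier_mat n n"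
  shows "poly (char_poly A) z = Determinant.det (z \<cdot>\<^sub>m 1\<^sub>m n - A)"
proof -
  have "- char_matrix A z = z \<cdot>\<^sub>m 1\<^sub>m n - A"
    using A by (intro eq_matI) (auto simp: char_matrix_def)
  thus ?thesis using char_poly_matrix[OF A, of z] by simp
qed

lemma geometric_resolvent_sums:
  fixes z e :: complex
  assumes "cmod e < cmod z"
  shows "(\<lambda>s. e ^ s / z ^ (s + 1)) sums (1 / (z - e))"
proof -
  have z: "z \<noteq> 0" using assms by auto
  have "cmod (e / z) < 1" using assms z by (simp add: norm_divide)
  from sums_mult[OF geometric_sums[OF this], of "1 / z"]
  have "(\<lambda>s. 1 / z * (e / z) ^ s) sums (1 / z * (1 / (1 - e / z)))" .
  moreover have "1 / z * (1 / (1 - e / z)) = 1 / (z - e)" using z by (simp add: field_simps)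
  ultimately show ?thesis by (simp add: power_divide field_simps)
qed

text \<open>The logarithmic derivative of the characteristic polynomial is the sum of \<open>1 / (z - \<nu>)\<close> over
  the eigenvalues \<open>\<nu>\<close>. Outside a disc containing all of them each term is a geometric series, and
  collecting equal powers of \<open>z\<close> gives the traces.
\<close>

lemma log_deriv_char_poly_sums:
  fixes A :: "complex mat"
  assumes A: "A \<in> carrier_mat n n"
    and row: "\<And>i. i < n \<Longrightarrow> (\<Sum>j<n. cmod (A $$ (i, j))) \<le> r" and z: "r < cmod z"
  defines "q \<equiv> (\<lambda>z. Determinant.det (z \<cdot>\<^sub>m 1\<^sub>m n - A))"
  shows "q z \<noteq> 0" "(\<lambda>s. mat_trace (A ^\<^sub>m s) / z ^ (s + 1)) sums (deriv q z / q z)"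
proof -
  obtain es where es: "char_poly A = (\<Prod>e\<leftarrow>es. [:- e, 1:])"
    using char_poly_factorized[OF A] by blast
  have ev: "eigenvalues_mset A = mset es"
    unfolding eigenvalues_mset_def by (rule proots_prod_linear[OF es])
  have le: "cmod e < cmod z" if "e \<in> set es" for e
    using eigenvalue_le_row_sum[OF A _ row, of e] that z unfolding ev by force
  have q: "q = poly (char_poly A)"
    unfolding q_def using char_poly_eval[OF A] by auto
  have d: "deriv q z = poly (pderiv (char_poly A)) z"
    unfolding q by (rule DERIV_imp_deriv[OF poly_DERIV])
  have "z \<notin> set es" using le by auto
  from log_deriv_prod_linear[OF this]
  have *: "q z \<noteq> 0" "deriv q z / q z = (\<Sum>e\<leftarrow>es. 1 / (z - e))"
    unfolding d unfolding q es by auto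
  show "q z \<noteq> 0" by fact
  have "(\<lambda>s. (\<Sum>e\<leftarrow>es. e ^ s / z ^ (s + 1))) sums (\<Sum>e\<leftarrow>es. 1 / (z - e))"
    using le
  proof (induction es)
    case (Cons e es)
    have "(\<lambda>s. e ^ s / z ^ (s + 1)) sums (1 / (z - e))"
      by (rule geometric_resolvent_sums) (use Cons.prems in auto)
    from sums_add[OF this Cons.IH] show ?case using Cons.prems by simp
  qed simp
  moreover have "(\<Sum>e\<leftarrow>es. e ^ s / z ^ (s + 1)) = mat_trace (A ^\<^sub>m s) / z ^ (s + 1)" for s
  proof -
    have "mat_trace (A ^\<^sub>m s) = (\<Sum>e\<leftarrow>es. e ^ s)"
      unfolding eigenvalue_power_sum_eq_trace[OF A, symmetric] ev
      by (metis mset_map sum_mset_sum_list)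
    thus ?thesis
      by (simp add: divide_inverse sum_list_mult_const)
  qed
  ultimately show "(\<lambda>s. mat_trace (A ^\<^sub>m s) / z ^ (s + 1)) sums (deriv q z / q z)"
    unfolding *(2) by simp
qed

section \<open>The band operator on square summable sequences\<close>

text \<open>A bound for the absolute row sums of every band matrix whose coefficients are bounded by \<open>C\<close>;
  it controls the operator for the supremum norm and for the square norm, and every truncation.
\<close>

definition band_bound :: "nat \<Rightarrow> real \<Rightarrow> real" where
  "band_bound p C = 1 + (real p + 1) * C"

text \<open>Membership in \<open>l2\<close> together with an upper bound for the norm. Testing on finite index sets gives
  access to the triangle inequality for finite square sums and makes the bound stable under
  pointwise limits, so that a series of sequences can be summed entry by entry.
\<close>

definition l2_le :: "(int \<Rightarrow> complex) \<Rightarrow> real \<Rightarrow> bool" where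
  "l2_le x N \<longleftrightarrow> (\<forall>F. finite F \<longrightarrow> L2_set (\<lambda>i. cmod (x i)) F \<le> N)"

lemma l2_leD: "l2_le x N \<Longrightarrow> finite F \<Longrightarrow> L2_set (\<lambda>i. cmod (x i)) F \<le> N"
  by (simp add: l2_le_def)

lemma l2_iff_l2_le: "x \<in> l2 \<longleftrightarrow> (\<exists>N. l2_le x N)"
proof
  assume "x \<in> l2"
  hence x: "(\<lambda>n. (cmod (x n))\<^sup>2) summable_on UNIV" by (simp add: l2_def)
  have "l2_le x (sqrt (\<Sum>\<^sub>\<infinity>n. (cmod (x n))\<^sup>2))"
    unfolding l2_le_def L2_set_def using x by (auto intro: finite_sum_le_infsum)
  thus "\<exists>N. l2_le x N" ..
next
  assume "\<exists>N. l2_le x N"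
  then obtain N where N: "l2_le x N" ..
  have "(\<Sum>i\<in>F. (cmod (x i))\<^sup>2) \<le> N\<^sup>2" if "finite F" for F
    using l2_leD[OF N that] unfolding L2_set_def by (rule sqrt_le_D)
  hence "bdd_above (sum (\<lambda>i. (cmod (x i))\<^sup>2) ` {F. F \<subseteq> UNIV \<and> finite F})"
    by (intro bdd_aboveI2[where M = "N\<^sup>2"]) simp
  hence "(\<lambda>i. (cmod (x i))\<^sup>2) summable_on UNIV"
    by (intro nonneg_bdd_above_summable_on) simp_all
  thus "x \<in> l2" by (simp add: l2_def)
qed

lemma l2_le_entry: "l2_le x N \<Longrightarrow> cmod (x i) \<le> N"
  using l2_leD[of x N "{i}"] by simp

lemma l2_le_nonneg: "l2_le x N \<Longrightarrow> 0 \<le> N"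
  using l2_leD[of x N "{}"] by simp

lemma L2_set_sum_le:
  assumes "finite I"
  shows "L2_set (\<lambda>i. \<Sum>k\<in>I. f k i) A \<le> (\<Sum>k\<in>I. L2_set (f k) A)"
  using assms
proof induction
  case (insert k I)
  show ?case
    using insert L2_set_triangle_ineq[of "f k" "\<lambda>i. \<Sum>k\<in>I. f k i" A] by simp
qed (simp add: L2_set_def)

lemma l2_le_sum:
  assumes "finite I" "\<And>k. k \<in> I \<Longrightarrow> l2_le (x k) (N k)"
  shows "l2_le (\<lambda>i. \<Sum>k\<in>I. x k i) (\<Sum>k\<in>I. N k)"
  unfolding l2_le_def
proof (intro allI impI)
  fix F :: "int set" assume F: "finite F"
  have "L2_set (\<lambda>i. cmod (\<Sum>k\<in>I. x k i)) F \<le> L2_set (\<lambda>i. \<Sum>k\<in>I. cmod (x k i)) F"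
    by (rule L2_set_mono) (auto intro: norm_sum)
  also have "\<dots> \<le> (\<Sum>k\<in>I. L2_set (\<lambda>i. cmod (x k i)) F)"
    by (rule L2_set_sum_le) fact
  also have "\<dots> \<le> (\<Sum>k\<in>I. N k)"
    by (intro sum_mono l2_leD assms F)
  finally show "L2_set (\<lambda>i. cmod (\<Sum>k\<in>I. x k i)) F \<le> (\<Sum>k\<in>I. N k)" .
qed

lemma l2_le_add:
  assumes "l2_le x M" "l2_le y N"
  shows "l2_le (\<lambda>i. x i + y i) (M + N)"
  \<comment> \<open>A sum of two sequences is a sum of a family indexed by the booleans.\<close>
  using l2_le_sum[of UNIV "case_bool x y" "case_bool M N"] assms
  by (simp add: UNIV_bool add.commute split: bool.split)

lemma l2_le_mult:
  assumes "l2_le x N" "\<And>i. cmod (c i) \<le> D"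
  shows "l2_le (\<lambda>i. c i * x i) (D * N)"
  unfolding l2_le_def
proof (intro allI impI)
  fix F :: "int set" assume F: "finite F"
  have D: "0 \<le> D" using assms(2)[of 0] norm_ge_zero order_trans by blast
  have "L2_set (\<lambda>i. cmod (c i * x i)) F \<le> L2_set (\<lambda>i. D * cmod (x i)) F"
    by (rule L2_set_mono) (auto simp: norm_mult intro: mult_right_mono assms)
  also have "\<dots> = D * L2_set (\<lambda>i. cmod (x i)) F"
    using D by (simp add: L2_set_right_distrib)
  also have "\<dots> \<le> D * N"
    using D l2_leD[OF assms(1) F] by (rule mult_left_mono[rotated])
  finally show "L2_set (\<lambda>i. cmod (c i * x i)) F \<le> D * N" .
qed

lemma l2_le_translate:
  assumes "l2_le x N"
  shows "l2_le (\<lambda>i. x (i + m)) N"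
  unfolding l2_le_def
proof (intro allI impI)
  fix F :: "int set" assume F: "finite F"
  have "L2_set (\<lambda>i. cmod (x (i + m))) F = L2_set (\<lambda>i. cmod (x i)) ((\<lambda>i. i + m) ` F)"
    unfolding L2_set_def by (subst sum.reindex) (auto simp: inj_on_def)
  thus "L2_set (\<lambda>i. cmod (x (i + m))) F \<le> N"
    using l2_leD[OF assms, of "(\<lambda>i. i + m) ` F"] F by simp
qed

lemma summable_geometric_majorant:
  fixes r w K :: real
  assumes "0 \<le> r" "r < w"
  shows "summable (\<lambda>s. K * r ^ s / w ^ (s + 1))"
proof -
  have "summable (\<lambda>s. K / w * (r / w) ^ s)"
    using assms by (intro summable_mult summable_geometric) auto
  thus ?thesis by (simp add: power_divide field_simps)
qed

locale bounded_band =
  fixes p :: nat and a :: "nat \<Rightarrow> int \<Rightarrow> complex" and C :: real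
  assumes C_nonneg: "0 \<le> C"
    and coeff_le: "k \<le> p \<Longrightarrow> cmod (a k j) \<le> C"
begin

abbreviation "T \<equiv> band_op p a"
abbreviation "B \<equiv> band_bound p C"

lemma B_ge_1: "1 \<le> B"
  using C_nonneg by (simp add: band_bound_def)

lemma band_op_sup:
  assumes "\<And>i. cmod (x i) \<le> N"
  shows "cmod (T x i) \<le> B * N"
proof -
  have "cmod (T x i) \<le> cmod (x (i + 1)) + (\<Sum>k\<le>p. cmod (a k (i - int k) * x (i - int k)))"
    unfolding band_op_eq by (intro norm_triangle_le add_left_mono norm_sum)
  also have "\<dots> \<le> N + (\<Sum>k\<le>p. C * N)"
    unfolding norm_mult using C_nonneg
    by (intro add_mono sum_mono mult_mono assms coeff_le) auto
  also have "\<dots> = B * N" by (simp add: band_bound_def algebra_simps)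
  finally show ?thesis .
qed

text \<open>The operator is a sum of \<open>p + 2\<close> translations, each followed by multiplication with a
  bounded sequence.
\<close>

lemma band_op_l2:
  assumes "l2_le x N"
  shows "l2_le (T x) (B * N)"
proof -
  \<comment> \<open>The coefficients are bounded for \<open>k \<le> p\<close> only; cutting them off makes the bound unconditional.\<close>
  define c where "c k j = (if k \<le> p then a k j else 0)" for k j
  have "cmod (c k j) \<le> C" for k j using coeff_le C_nonneg by (simp add: c_def)
  hence "l2_le (\<lambda>i. x (i + 1) + (\<Sum>k\<le>p. c k (i - int k) * x (i + (- int k)))) (N + (\<Sum>k\<le>p. C * N))"
    by (intro l2_le_add l2_le_sum l2_le_mult l2_le_translate assms) auto
  moreover have "(\<lambda>i. x (i + 1) + (\<Sum>k\<le>p. c k (i - int k) * x (i + (- int k)))) = T x"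
    by (auto simp: band_op_eq c_def)
  moreover have "N + (\<Sum>k\<le>p. C * N) = B * N" by (simp add: band_bound_def algebra_simps)
  ultimately show ?thesis by simp
qed

lemma iterate_sup:
  assumes "\<And>i. cmod (x i) \<le> N"
  shows "cmod ((T ^^ s) x i) \<le> B ^ s * N"
proof (induction s arbitrary: i)
  case (Suc s)
  from band_op_sup[of "(T ^^ s) x", OF Suc] show ?case by (simp add: mult_ac)
qed (use assms in auto)

lemma iterate_l2:
  assumes "l2_le x N"
  shows "l2_le ((T ^^ s) x) (B ^ s * N)"
proof (induction s)
  case (Suc s)
  from band_op_l2[OF this] show ?case by (simp add: mult_ac)
qed (use assms in auto)

lemma norm_basis_le: "cmod (l2_basis j i) \<le> 1"
  by (simp add: l2_basis_def)

lemma l2_le_basis: "l2_le (l2_basis j) 1"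
  unfolding l2_le_def L2_set_def
proof (intro allI impI)
  fix F :: "int set" assume "finite F"
  hence "(\<Sum>i\<in>F. (cmod (l2_basis j i))\<^sup>2) \<le> 1"
    by (simp add: l2_basis_def if_distrib[of "\<lambda>x. x\<^sup>2"] if_distrib[of cmod] cong: if_cong)
  thus "sqrt (\<Sum>i\<in>F. (cmod (l2_basis j i))\<^sup>2) \<le> 1" by simp
qed

text \<open>The Neumann series of the resolvent applied to \<open>y\<close>, summed entry by entry because \<open>l2\<close> is a
  set of functions and not a normed type.
\<close>

definition neumann :: "complex \<Rightarrow> (int \<Rightarrow> complex) \<Rightarrow> int \<Rightarrow> complex" where
  "neumann z y i = (\<Sum>s. (T ^^ s) y i / z ^ (s + 1))"

context
  fixes z :: complex
  assumes z: "B < cmod z"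
begin

lemma z_nonzero: "z \<noteq> 0"
  using z B_ge_1 by auto

lemma neumann_term_le:
  assumes "\<And>i. cmod (y i) \<le> N"
  shows "cmod ((T ^^ s) y i / z ^ (s + 1)) \<le> B ^ s * N / cmod z ^ (s + 1)"
  unfolding norm_divide norm_power
  by (intro divide_right_mono iterate_sup assms) simp

lemma neumann_abs_summable:
  assumes "\<And>i. cmod (y i) \<le> N"
  shows "summable (\<lambda>s. cmod ((T ^^ s) y i / z ^ (s + 1)))"
proof (rule summable_comparison_test')
  show "summable (\<lambda>s. N * B ^ s / cmod z ^ (s + 1))"
    using B_ge_1 z by (intro summable_geometric_majorant) auto
  show "norm (cmod ((T ^^ s) y i / z ^ (s + 1))) \<le> N * B ^ s / cmod z ^ (s + 1)" for s
    using neumann_term_le[OF assms] by (simp add: mult.commute)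
qed

lemma neumann_summable:
  assumes "\<And>i. cmod (y i) \<le> N"
  shows "summable (\<lambda>s. (T ^^ s) y i / z ^ (s + 1))"
  by (rule summable_norm_cancel[OF neumann_abs_summable[OF assms]])

text \<open>Applying the operator to the series shifts it by one index, and each entry of the image
  involves only finitely many entries, so the shift is exact and everything but the term \<open>y\<close>
  cancels.
\<close>

lemma shifted_op_neumann:
  assumes y: "\<And>i. cmod (y i) \<le> N"
  shows "shifted_op p a z (neumann z y) = y"
proof
  fix i
  note sums = summable_sums[OF neumann_summable[OF y], folded neumann_def]
  have "(\<lambda>s. z * ((T ^^ s) y i / z ^ (s + 1))) sums (z * neumann z y i)"
    by (intro sums_mult sums)
  hence "(\<lambda>s. (T ^^ s) y i / z ^ s) sums (z * neumann z y i)"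
    using z_nonzero by simp
  hence 1: "(\<lambda>s. (T ^^ (s + 1)) y i / z ^ (s + 1)) sums (z * neumann z y i - y i)"
    using sums_Suc_iff[of "\<lambda>s. (T ^^ s) y i / z ^ s" "z * neumann z y i - y i"] by simp
  have "(\<lambda>s. (T ^^ s) y (i + 1) / z ^ (s + 1)
        + (\<Sum>k\<le>p. a k (i - int k) * ((T ^^ s) y (i - int k) / z ^ (s + 1))))
      sums (neumann z y (i + 1) + (\<Sum>k\<le>p. a k (i - int k) * neumann z y (i - int k)))"
    by (intro sums_add sums_sum sums_mult sums)
  hence "(\<lambda>s. (T ^^ (s + 1)) y i / z ^ (s + 1)) sums T (neumann z y) i"
    by (simp add: band_op_eq add_divide_distrib sum_divide_distrib)
  with 1 have "T (neumann z y) i = z * neumann z y i - y i"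
    using sums_unique2 by blast
  thus "shifted_op p a z (neumann z y) i = y i"
    by (simp add: shifted_op_def)
qed

text \<open>All partial sums obey the same norm bound, which passes to the pointwise limit on each finite
  index set.
\<close>

lemma neumann_in_l2:
  assumes "l2_le y N"
  shows "neumann z y \<in> l2"
proof -
  define S where "S = (\<Sum>s. N * B ^ s / cmod z ^ (s + 1))"
  have y: "cmod (y i) \<le> N" for i by (rule l2_le_entry[OF assms])
  have N: "0 \<le> N" by (rule l2_le_nonneg[OF assms])
  have B0: "0 \<le> B" using B_ge_1 by simp
  have part: "l2_le (\<lambda>i. \<Sum>s<n. (T ^^ s) y i / z ^ (s + 1)) S" for n
  proof -
    have "l2_le (\<lambda>i. \<Sum>s<n. 1 / z ^ (s + 1) * (T ^^ s) y i) (\<Sum>s<n. 1 / cmod z ^ (s + 1) * (B ^ s * N))"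
      by (intro l2_le_sum l2_le_mult iterate_l2 assms) (auto simp: norm_divide norm_power norm_mult)
    moreover have "(\<Sum>s<n. N * B ^ s / cmod z ^ (s + 1)) \<le> S"
      unfolding S_def using N B0 z by (intro sum_le_suminf summable_geometric_majorant) auto
    ultimately show ?thesis
      unfolding l2_le_def by (auto simp: mult.commute intro: order_trans)
  qed
  have "l2_le (neumann z y) S"
    unfolding l2_le_def
  proof (intro allI impI)
    fix F :: "int set" assume F: "finite F"
    have "(\<lambda>n. \<Sum>s<n. (T ^^ s) y i / z ^ (s + 1)) \<longlonglongrightarrow> neumann z y i" for i
      unfolding neumann_def by (rule summable_LIMSEQ, rule neumann_summable, rule y)
    hence "(\<lambda>n. L2_set (\<lambda>i. cmod (\<Sum>s<n. (T ^^ s) y i / z ^ (s + 1))) F)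
        \<longlonglongrightarrow> L2_set (\<lambda>i. cmod (neumann z y i)) F"
      unfolding L2_set_def by (intro tendsto_intros)
    thus "L2_set (\<lambda>i. cmod (neumann z y i)) F \<le> S"
      by (rule LIMSEQ_le_const2) (use l2_leD[OF part F] in auto)
  qed
  thus ?thesis unfolding l2_iff_l2_le ..
qed

text \<open>A solution of \<open>T x = z x\<close> satisfies \<open>T ^^ s x = z ^ s x\<close>, while the left side grows at most like
  \<open>B ^ s\<close> and \<open>|z| > B\<close>. Differences of square summable sequences are bounded, which gives injectivity
  on \<open>l2\<close>.
\<close>

lemma bounded_kernel_zero:
  assumes x: "\<And>i. cmod (x i) \<le> N" and ker: "\<And>i. z * x i = T x i"
  shows "x i = 0"
proof -
  have iter: "(T ^^ s) x = (\<lambda>i. z ^ s * x i)" for s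
  proof (induction s)
    case (Suc s)
    have "T (\<lambda>i. z ^ s * x i) i = z ^ s * T x i" for i
      by (simp add: band_op_eq sum_distrib_left algebra_simps)
    thus ?case using Suc by (simp flip: ker add: mult_ac)
  qed simp
  have "cmod (x i) \<le> N * (B / cmod z) ^ s" for s
    using iterate_sup[of x N s i, OF x] z_nonzero unfolding iter
    by (simp add: norm_mult norm_power power_divide field_simps)
  moreover have "(\<lambda>s. N * (B / cmod z) ^ s) \<longlonglongrightarrow> N * 0"
    using z B_ge_1 z_nonzero by (intro tendsto_mult_left LIMSEQ_power_zero) simp
  ultimately have "cmod (x i) \<le> 0"
    by (intro LIMSEQ_le_const[of "\<lambda>s. N * (B / cmod z) ^ s"]) auto
  thus ?thesis by simp
qed

lemma shifted_op_bij: "bij_betw (shifted_op p a z) l2 l2"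
  unfolding bij_betw_def
proof
  show "inj_on (shifted_op p a z) l2"
  proof (rule inj_onI)
    fix x y assume xy: "x \<in> l2" "y \<in> l2" "shifted_op p a z x = shifted_op p a z y"
    obtain M N where MN: "l2_le x M" "l2_le y N" using xy unfolding l2_iff_l2_le by blast
    have "x i - y i = 0" for i
    proof (rule bounded_kernel_zero[where N = "M + N"])
      show "cmod (x i - y i) \<le> M + N" for i
        using norm_triangle_ineq4[of "x i" "y i"] l2_le_entry[OF MN(1), of i] l2_le_entry[OF MN(2), of i] by linarith
      show "z * (x i - y i) = T (\<lambda>i. x i - y i) i" for i
        using fun_cong[OF xy(3), of i]
        by (simp add: shifted_op_def band_op_eq sum_subtractf algebra_simps)
    qed
    thus "x = y" by auto
  qed
  have "shifted_op p a z x \<in> l2" if "x \<in> l2" for x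
  proof -
    obtain N where "l2_le x N" using \<open>x \<in> l2\<close> unfolding l2_iff_l2_le by blast
    hence "l2_le (\<lambda>i. z * x i + (-1) * T x i) (cmod z * N + 1 * (B * N))"
      by (intro l2_le_add l2_le_mult band_op_l2) auto
    thus ?thesis unfolding l2_iff_l2_le shifted_op_def by auto
  qed
  moreover have "y \<in> shifted_op p a z ` l2" if "y \<in> l2" for y
  proof -
    obtain N where N: "l2_le y N" using \<open>y \<in> l2\<close> unfolding l2_iff_l2_le by blast
    show ?thesis
      using shifted_op_neumann[of y N, OF l2_le_entry[OF N]] neumann_in_l2[OF N] by force
  qed
  ultimately show "shifted_op p a z ` l2 = l2" by blast
qed

text \<open>By injectivity the preimage of the basis vector is the Neumann series, whose entry at \<open>0\<close> is the
  inner product with the basis vector.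
\<close>

lemma resolvent_fun_eq: "resolvent_fun p a z = (\<Sum>s. (T ^^ s) (l2_basis 0) 0 / z ^ (s + 1))"
proof -
  have "inv_into l2 (shifted_op p a z) (l2_basis 0) = neumann z (l2_basis 0)"
    by (rule inv_into_f_eq)
      (use shifted_op_bij shifted_op_neumann[OF norm_basis_le] neumann_in_l2[OF l2_le_basis]
        in \<open>auto simp: bij_betw_def\<close>)
  moreover have "l2_inner x (l2_basis 0) = x 0" for x
  proof -
    have "(\<Sum>\<^sub>\<infinity>n. x n * cnj (l2_basis 0 n)) = (\<Sum>\<^sub>\<infinity>n\<in>{0}. x n * cnj (l2_basis 0 n))"
      by (rule infsum_cong_neutral) (auto simp: l2_basis_def)
    thus ?thesis by (simp add: l2_inner_def l2_basis_def)
  qed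
  ultimately show ?thesis by (simp add: resolvent_fun_def neumann_def)
qed

end

text \<open>The Neumann series is itself the Laurent expansion: it converges absolutely, and the entry of
  \<open>T ^^ s\<close> comes with the exponent \<open>- (s + 1)\<close>.
\<close>

lemma is_laurent_resolvent:
  "is_laurent_at_infinity (resolvent_fun p a)
     (\<lambda>k. if k \<ge> 1 then (T ^^ nat (k - 1)) (l2_basis 0) 0 else 0)" (is "is_laurent_at_infinity _ ?c")
  unfolding is_laurent_at_infinity_def
proof (intro exI[of _ B] conjI allI impI)
  show "B > 0" using B_ge_1 by simp
  fix z :: complex assume z: "B < cmod z"
  have "((\<lambda>s. (T ^^ s) (l2_basis 0) 0 / z ^ (s + 1)) has_sum resolvent_fun p a z) UNIV"
    unfolding resolvent_fun_eq[OF z]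
    by (intro norm_summable_imp_has_sum neumann_abs_summable[OF z norm_basis_le]
        summable_sums neumann_summable[OF z norm_basis_le])
  also have "?this \<longleftrightarrow> ((\<lambda>k. ?c k * z powi (- k)) has_sum resolvent_fun p a z) {1..}"
  proof (rule has_sum_reindex_bij_witness[of _ "\<lambda>k. nat (k - 1)" "\<lambda>s. int s + 1"])
    fix s :: nat
    have "z powi (- (int s + 1)) = 1 / z ^ (s + 1)"
      unfolding power_int_minus using power_int_of_nat[of z "s + 1"] by (simp add: field_simps)
    thus "?c (int s + 1) * z powi (- (int s + 1)) = (T ^^ s) (l2_basis 0) 0 / z ^ (s + 1)"
      by simp
  qed auto
  also have "\<dots> \<longleftrightarrow> ((\<lambda>k. ?c k * z powi (- k)) has_sum resolvent_fun p a z) UNIV"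
    by (rule has_sum_cong_neutral) auto
  finally show "((\<lambda>k. ?c k * z powi (- k)) has_sum resolvent_fun p a z) UNIV" .
qed

lemma laurent_coeff_resolvent:
  "laurent_coeff (resolvent_fun p a) (int s + 1) = (T ^^ s) (l2_basis 0) 0"
  using laurent_coeff_eqI[OF is_laurent_resolvent] by simp

end

section \<open>Finite truncations of the band operator\<close>

lemma band_op_cong:
  assumes "\<And>k j. k \<le> p \<Longrightarrow> a k j = b k j"
  shows "band_op p a = band_op p b"
  using assms by (auto simp: band_op_eq fun_eq_iff)

lemma iterate_Suc_entry:
  "(band_op p a ^^ Suc s) x i
    = (band_op p a ^^ s) x (i + 1) + (\<Sum>k\<le>p. a k (i - int k) * (band_op p a ^^ s) x (i - int k))"
  by (simp only: funpow.simps o_apply band_op_eq[of _ _ "(band_op p a ^^ s) x"])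

text \<open>Translating the coefficients moves the matrix along its diagonal. With the stationarity of the
  coefficients this makes all diagonal entries of a power equally distributed.
\<close>

lemma iterate_translate:
  "(band_op p (\<lambda>k j. a k (j + m)) ^^ s) (l2_basis j) i = (band_op p a ^^ s) (l2_basis (j + m)) (i + m)"
proof (induction s arbitrary: i)
  case 0
  show ?case by (simp add: l2_basis_def)
next
  case (Suc s)
  have "i + m - int k = i - int k + m" for k by simp
  moreover have "i + m + 1 = i + 1 + m" by simp
  ultimately show ?case by (simp only: iterate_Suc_entry Suc)
qed

lemma band_op_finite_support:
  assumes "finite J" "\<And>j. j \<notin> J \<Longrightarrow> x j = 0"
  shows "band_op p a x i = (\<Sum>j\<in>J. band_entry p a i j * x j)"
proof -
  have "band_op p a x i = (\<Sum>\<^sub>\<infinity>j\<in>J. band_entry p a i j * x j)"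
    unfolding band_op_def by (rule infsum_cong_neutral) (use assms in auto)
  thus ?thesis using assms by simp
qed

text \<open>One application of the operator moves mass up by at most \<open>p\<close> places and down by at most one.
\<close>

lemma iterate_support:
  assumes "(band_op p a ^^ s) (l2_basis j) i \<noteq> 0"
  shows "j - int s \<le> i \<and> i \<le> j + int (p * s)"
  using assms
proof (induction s arbitrary: i)
  case 0
  thus ?case by (simp add: l2_basis_def split: if_splits)
next
  case (Suc s)
  let ?x = "(band_op p a ^^ s) (l2_basis j)"
  have "?x (i + 1) \<noteq> 0 \<or> (\<exists>k\<le>p. ?x (i - int k) \<noteq> 0)"
  proof (rule ccontr)
    assume "\<not> ?thesis"
    hence "band_op p a ?x i = 0" by (auto simp: band_op_eq intro!: sum.neutral)
    thus False using Suc.prems by simp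
  qed
  thus ?case
  proof
    assume "?x (i + 1) \<noteq> 0"
    from Suc.IH[OF this] show ?thesis by (simp add: algebra_simps)
  next
    assume "\<exists>k\<le>p. ?x (i - int k) \<noteq> 0"
    then obtain k where k: "k \<le> p" "?x (i - int k) \<noteq> 0" by blast
    from Suc.IH[OF k(2)] k(1) show ?thesis by (simp add: algebra_simps)
  qed
qed

lemma pow_mat_Suc_left:
  fixes A :: "'a :: semiring_1 mat"
  assumes A: "A \<in> carrier_mat n n"
  shows "A ^\<^sub>m Suc s = A * A ^\<^sub>m s"
proof (induction s)
  case (Suc s)
  have "A ^\<^sub>m Suc (Suc s) = (A * A ^\<^sub>m s) * A" using Suc by simp
  also have "\<dots> = A * (A ^\<^sub>m s * A)" using A by (intro assoc_mult_mat[of _ n n _ n _ n]) auto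
  finally show ?case by simp
qed (use A in auto)

lemma band_trunc_carrier: "band_trunc p a n \<in> carrier_mat n n"
  by (simp add: band_trunc_def)

lemma band_trunc_entry:
  "i < n \<Longrightarrow> j < n \<Longrightarrow>
     band_trunc p a n $$ (i, j) = band_entry p a (window_start n + int i) (window_start n + int j)"
  by (simp add: band_trunc_def)

lemma mat_trace_band_trunc:
  "mat_trace (band_trunc p a n ^\<^sub>m s) = (\<Sum>i<n. (band_trunc p a n ^\<^sub>m s) $$ (i, i))"
  using band_trunc_carrier[of p a n] by (simp add: mat_trace_def)

text \<open>Starting at \<open>j\<close>, at most \<open>s\<close> steps of the operator do not leave the window when \<open>j\<close> has
  distance \<open>s\<close> from its lower and \<open>p * s\<close> from its upper end, so the truncation is not felt.
\<close>

lemma band_trunc_pow_interior: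
  assumes "i < n" "s \<le> j" "j + p * s < n"
  shows "(band_trunc p a n ^\<^sub>m s) $$ (i, j)
    = (band_op p a ^^ s) (l2_basis (window_start n + int j)) (window_start n + int i)"
  using assms
proof (induction s arbitrary: i)
  case 0
  thus ?case by (simp add: l2_basis_def band_trunc_def)
next
  case (Suc s)
  let ?w = "window_start n" and ?A = "band_trunc p a n"
  let ?x = "(band_op p a ^^ s) (l2_basis (?w + int j))"
  have A: "?A \<in> carrier_mat n n" and As: "?A ^\<^sub>m s \<in> carrier_mat n n"
    using band_trunc_carrier[of p a n] by auto
  have j: "j < n" using Suc.prems by simp
  have supp: "?x l = 0" if "l \<notin> (\<lambda>i. ?w + int i) ` {..<n}" for l
  proof (rule ccontr)
    assume "?x l \<noteq> 0"
    from iterate_support[OF this] Suc.prems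
    have "?w \<le> l" "l \<le> ?w + int (j + p * s)" by auto
    moreover have "int (j + p * s) < int n" using Suc.prems(3) by (subst of_nat_less_iff) simp
    ultimately have "?w \<le> l" "l < ?w + int n" by linarith+
    hence "l = ?w + int (nat (l - ?w))" "nat (l - ?w) < n" by auto
    thus False using that by blast
  qed
  have "(?A ^\<^sub>m Suc s) $$ (i, j) = (\<Sum>k<n. ?A $$ (i, k) * (?A ^\<^sub>m s) $$ (k, j))"
    unfolding pow_mat_Suc_left[OF A] by (rule mat_mult_entry[OF A As \<open>i < n\<close> j])
  also have "\<dots> = (\<Sum>k<n. band_entry p a (?w + int i) (?w + int k) * ?x (?w + int k))"
    using Suc by (intro sum.cong) (auto simp: band_trunc_entry)
  also have "\<dots> = (\<Sum>l\<in>(\<lambda>i. ?w + int i) ` {..<n}. band_entry p a (?w + int i) l * ?x l)"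
    by (subst sum.reindex) (auto simp: inj_on_def)
  also have "\<dots> = band_op p a ?x (?w + int i)"
    by (rule band_op_finite_support[symmetric]) (use supp in auto)
  finally show ?case by simp
qed

context bounded_band
begin

lemma band_entry_row_sum:
  assumes J: "finite J"
  shows "(\<Sum>j\<in>J. cmod (band_entry p a i j)) \<le> B"
proof -
  have "(\<Sum>j\<in>J. cmod (band_entry p a i j)) = (\<Sum>j\<in>J \<inter> {i - int p..i + 1}. cmod (band_entry p a i j))"
    by (rule sum.mono_neutral_right) (use J in \<open>auto simp: band_entry_def\<close>)
  also have "\<dots> \<le> (\<Sum>j\<in>{i - int p..i + 1}. cmod (band_entry p a i j))"
    by (rule sum_mono2) auto
  also have "{i - int p..i + 1} = insert (i + 1) {i - int p..i}" by auto
  also have "(\<Sum>j\<in>\<dots>. cmod (band_entry p a i j)) = 1 + (\<Sum>j\<in>{i - int p..i}. cmod (a (nat (i - j)) j))"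
    by (simp add: band_entry_def)
  also have "\<dots> \<le> 1 + (\<Sum>j\<in>{i - int p..i}. C)"
    by (intro add_left_mono sum_mono coeff_le) auto
  also have "\<dots> = B" by (simp add: band_bound_def algebra_simps)
  finally show ?thesis .
qed

lemma band_trunc_row_sum:
  assumes "i < n"
  shows "(\<Sum>j<n. cmod (band_trunc p a n $$ (i, j))) \<le> B"
proof -
  let ?w = "window_start n"
  have "(\<Sum>j<n. cmod (band_trunc p a n $$ (i, j)))
      = (\<Sum>l\<in>(\<lambda>i. ?w + int i) ` {..<n}. cmod (band_entry p a (?w + int i) l))"
    using assms by (subst sum.reindex) (auto simp: inj_on_def band_trunc_entry)
  thus ?thesis by (simp add: band_entry_row_sum)
qed

lemma band_trunc_pow_entry_le:
  "i < n \<Longrightarrow> j < n \<Longrightarrow> cmod ((band_trunc p a n ^\<^sub>m s) $$ (i, j)) \<le> B ^ s"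
  using pow_mat_entry_le[OF band_trunc_carrier band_trunc_row_sum] B_ge_1 by simp

lemma mat_trace_band_trunc_le: "cmod (mat_trace (band_trunc p a n ^\<^sub>m s)) \<le> real n * B ^ s"
  unfolding mat_trace_band_trunc
  using sum_norm_bound[of "{..<n}" "\<lambda>i. (band_trunc p a n ^\<^sub>m s) $$ (i, i)" "B ^ s"]
  by (simp add: band_trunc_pow_entry_le)

lemma iterate_basis_le: "cmod ((T ^^ s) (l2_basis j) i) \<le> B ^ s"
  using iterate_sup[of "l2_basis j" 1 s i] by (simp add: l2_basis_def)

text \<open>Only diagonal places near the two ends of the window, at most \<open>s + p * s\<close> of them, contribute
  an error, and each contributes a bounded one; the bound is uniform in \<open>n\<close>, hence negligible after division by \<open>n\<close>.
\<close>

lemma mat_trace_band_trunc_approx: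
  "cmod (mat_trace (band_trunc p a n ^\<^sub>m s)
      - (\<Sum>i<n. (T ^^ s) (l2_basis (window_start n + int i)) (window_start n + int i)))
    \<le> real (s + p * s) * (2 * B ^ s)"
proof -
  let ?d = "\<lambda>i. (band_trunc p a n ^\<^sub>m s) $$ (i, i)
    - (T ^^ s) (l2_basis (window_start n + int i)) (window_start n + int i)"
  let ?bad = "{i. i < n \<and> \<not> (s \<le> i \<and> i + p * s < n)}"
  have "?bad \<subseteq> {..<s} \<union> {n - p * s..<n}" by auto
  hence "card ?bad \<le> card ({..<s} \<union> {n - p * s..<n})" by (intro card_mono) auto
  also have "\<dots> \<le> s + p * s" by (rule order_trans[OF card_Un_le]) simp
  finally have card: "card ?bad \<le> s + p * s" .
  have "(\<Sum>i<n. ?d i) = (\<Sum>i\<in>?bad. ?d i)"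
    by (rule sum.mono_neutral_right) (auto simp: band_trunc_pow_interior)
  hence eq: "mat_trace (band_trunc p a n ^\<^sub>m s)
      - (\<Sum>i<n. (T ^^ s) (l2_basis (window_start n + int i)) (window_start n + int i)) = (\<Sum>i\<in>?bad. ?d i)"
    by (simp add: mat_trace_band_trunc sum_subtractf)
  have "cmod (\<Sum>i\<in>?bad. ?d i) \<le> real (card ?bad) * (2 * B ^ s)"
  proof (rule sum_norm_bound)
    fix i assume "i \<in> ?bad"
    hence i: "i < n" by simp
    show "cmod (?d i) \<le> 2 * B ^ s"
      using norm_triangle_ineq4[of "(band_trunc p a n ^\<^sub>m s) $$ (i, i)"
          "(T ^^ s) (l2_basis (window_start n + int i)) (window_start n + int i)"]
        band_trunc_pow_entry_le[OF i i, of s]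
        iterate_basis_le[of s "window_start n + int i" "window_start n + int i"] by linarith
  qed
  also have "\<dots> \<le> real (s + p * s) * (2 * B ^ s)"
    using card B_ge_1 by (intro mult_right_mono) (simp_all del: of_nat_add of_nat_mult)
  finally show ?thesis unfolding eq .
qed

end

section \<open>Bounded independent coefficients\<close>

lemma iterate_measurable:
  assumes "\<And>k j. k \<le> p \<Longrightarrow> (\<lambda>\<omega>. a k j \<omega>) \<in> borel_measurable M"
  shows "(\<lambda>\<omega>. (band_op p (\<lambda>k j. a k j \<omega>) ^^ s) x i) \<in> borel_measurable M"
proof (induction s arbitrary: i)
  case (Suc s)
  show ?case
    unfolding iterate_Suc_entry
    by (intro borel_measurable_add borel_measurable_sum borel_measurable_times Suc assms) auto
qed simp

lemma band_entry_measurable: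
  assumes "\<And>k j. k \<le> p \<Longrightarrow> (\<lambda>\<omega>. a k j \<omega>) \<in> borel_measurable M"
  shows "(\<lambda>\<omega>. band_entry p (\<lambda>k j. a k j \<omega>) i j) \<in> borel_measurable M"
  unfolding band_entry_def
  by (cases "i = j - 1"; cases "j \<le> i \<and> i \<le> j + int p") (auto intro!: assms)

lemma band_trunc_pow_measurable:
  assumes a: "\<And>k j. k \<le> p \<Longrightarrow> (\<lambda>\<omega>. a k j \<omega>) \<in> borel_measurable M"
    and "i < n" "j < n"
  shows "(\<lambda>\<omega>. (band_trunc p (\<lambda>k j. a k j \<omega>) n ^\<^sub>m s) $$ (i, j)) \<in> borel_measurable M"
  using assms(2,3)
proof (induction s arbitrary: j)
  case 0
  thus ?case by (simp add: band_trunc_def)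
next
  case (Suc s)
  let ?A = "\<lambda>\<omega>. band_trunc p (\<lambda>k j. a k j \<omega>) n"
  have entry: "(\<lambda>\<omega>. ?A \<omega> $$ (k, l)) \<in> borel_measurable M" if "k < n" "l < n" for k l
    using that by (simp add: band_trunc_entry band_entry_measurable a)
  have "(?A \<omega> ^\<^sub>m Suc s) $$ (i, j) = (\<Sum>k<n. (?A \<omega> ^\<^sub>m s) $$ (i, k) * ?A \<omega> $$ (k, j))" for \<omega>
    unfolding pow_mat.simps
    by (rule mat_mult_entry[OF _ band_trunc_carrier Suc.prems])
      (use band_trunc_carrier[of p "\<lambda>k j. a k j \<omega>" n] in simp)
  thus ?case
    using Suc entry by (auto intro!: borel_measurable_sum borel_measurable_times)
qed

text \<open>A geometric majorant outside the disc of radius \<open>r\<close> allows the expectation to be taken term by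
  term.
\<close>

lemma (in prob_space) expectation_power_series:
  fixes f :: "nat \<Rightarrow> 'a \<Rightarrow> complex" and z :: complex
  assumes f [measurable]: "\<And>s. f s \<in> borel_measurable M"
    and bound: "\<And>s \<omega>. \<omega> \<in> space M \<Longrightarrow> cmod (f s \<omega>) \<le> K * r ^ s"
    and r: "0 \<le> r" "r < cmod z"
  shows "integrable M (\<lambda>\<omega>. \<Sum>s. f s \<omega> / z ^ (s + 1))"
    and "(\<lambda>s. expectation (f s) / z ^ (s + 1)) sums expectation (\<lambda>\<omega>. \<Sum>s. f s \<omega> / z ^ (s + 1))"
proof -
  have major: "summable (\<lambda>s. K * r ^ s / cmod z ^ (s + 1))"
    by (rule summable_geometric_majorant[OF r])
  have term_le: "norm (f s \<omega> / z ^ (s + 1)) \<le> K * r ^ s / cmod z ^ (s + 1)" if "\<omega> \<in> space M" for s \<omega>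
    unfolding norm_divide norm_power by (intro divide_right_mono bound that) simp
  have int: "integrable M (\<lambda>\<omega>. f s \<omega> / z ^ (s + 1))" for s
    by (rule integrable_const_bound[where B = "K * r ^ s / cmod z ^ (s + 1)"])
      (use term_le in \<open>auto simp del: power_Suc\<close>)
  have 1: "AE \<omega> in M. summable (\<lambda>s. norm (f s \<omega> / z ^ (s + 1)))"
  proof (rule AE_I2)
    fix \<omega> assume "\<omega> \<in> space M"
    thus "summable (\<lambda>s. norm (f s \<omega> / z ^ (s + 1)))"
      by (intro summable_comparison_test'[OF major, of 0]) (use term_le in auto)
  qed
  have 2: "summable (\<lambda>s. expectation (\<lambda>\<omega>. norm (f s \<omega> / z ^ (s + 1))))"
  proof (rule summable_comparison_test'[OF major, of 0])
    fix s
    have "expectation (\<lambda>\<omega>. norm (f s \<omega> / z ^ (s + 1))) \<le> K * r ^ s / cmod z ^ (s + 1)"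
      using integral_mono[OF integrable_norm[OF int[of s]], of "\<lambda>_. K * r ^ s / cmod z ^ (s + 1)"]
        term_le prob_space by simp
    thus "norm (expectation (\<lambda>\<omega>. norm (f s \<omega> / z ^ (s + 1)))) \<le> K * r ^ s / cmod z ^ (s + 1)"
      by (simp del: power_Suc)
  qed
  show "integrable M (\<lambda>\<omega>. \<Sum>s. f s \<omega> / z ^ (s + 1))"
    by (rule integrable_suminf[OF int 1 2])
  show "(\<lambda>s. expectation (f s) / z ^ (s + 1)) sums expectation (\<lambda>\<omega>. \<Sum>s. f s \<omega> / z ^ (s + 1))"
    using sums_integral[OF int 1 2] by (simp del: power_Suc)
qed

text \<open>By independence the joint law is a product measure, whose factor at \<open>(k, j)\<close> depends on \<open>k\<close> only.
  Reindexing by a translation of \<open>j\<close> therefore preserves it, and \<open>G\<close> cannot tell the translated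
  family from the original one.
\<close>

lemma (in prob_space) iid_family_translation_invariant:
  fixes a :: "nat \<Rightarrow> int \<Rightarrow> 'a \<Rightarrow> complex" and G :: "(nat \<times> int \<Rightarrow> complex) \<Rightarrow> complex"
  assumes a: "\<And>k j. k \<le> p \<Longrightarrow> a k j \<in> borel_measurable M"
    and dist: "\<And>k j. k \<le> p \<Longrightarrow> distr M borel (a k j) = \<mu> k"
    and ind: "indep_vars (\<lambda>_. borel) (\<lambda>(k, j). a k j) ({..p} \<times> UNIV)"
    and G: "G \<in> borel_measurable (\<Pi>\<^sub>M i\<in>{..p} \<times> UNIV. borel)"
  shows "expectation (\<lambda>\<omega>. G (\<lambda>(k, j)\<in>{..p} \<times> UNIV. a k (j + m) \<omega>))
    = expectation (\<lambda>\<omega>. G (\<lambda>(k, j)\<in>{..p} \<times> UNIV. a k j \<omega>))"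
proof -
  define I :: "(nat \<times> int) set" where "I = {..p} \<times> UNIV"
  define X where "X \<omega> = (\<lambda>(k, j)\<in>I. a k j \<omega>)" for \<omega>
  define sh where "sh = (\<lambda>(k, j). (k :: nat, j + m :: int))"
  define S where "S f = (\<lambda>i\<in>I. f (sh i))" for f :: "nat \<times> int \<Rightarrow> complex"
  let ?N = "\<Pi>\<^sub>M i\<in>I. (borel :: complex measure)"
  let ?L = "\<lambda>i. distr M borel (case i of (k, j) \<Rightarrow> a k j)"
  have I: "I \<noteq> {}" by (auto simp: I_def)
  have X: "X \<in> measurable M ?N"
    unfolding X_def by (rule measurable_restrict) (auto simp: I_def a)
  have law: "distr M ?N X = (\<Pi>\<^sub>M i\<in>I. ?L i)"
    using indep_vars_iff_distr_eq_PiM'[OF I, of "\<lambda>(k, j). a k j" "\<lambda>_. borel"] ind a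
    unfolding X_def I_def by (auto simp: case_prod_unfold)
  have L_sh: "?L (sh i) = ?L i" if "i \<in> I" for i
    using that dist by (auto simp: sh_def I_def)
  have "distr (\<Pi>\<^sub>M i\<in>I. ?L i) (\<Pi>\<^sub>M i\<in>I. ?L (sh i)) S = (\<Pi>\<^sub>M i\<in>I. ?L (sh i))"
    unfolding S_def
    by (rule distr_PiM_reindex)
      (auto simp: sh_def I_def inj_on_def intro!: prob_space_distr a)
  moreover have "(\<Pi>\<^sub>M i\<in>I. ?L (sh i)) = (\<Pi>\<^sub>M i\<in>I. ?L i)"
    by (rule PiM_cong) (use L_sh in auto)
  ultimately have "distr (distr M ?N X) (distr M ?N X) S = distr M ?N X"
    unfolding law by simp
  hence inv: "distr (distr M ?N X) ?N S = distr M ?N X"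
    using distr_cong[of "distr M ?N X" "distr M ?N X" ?N "distr M ?N X" S S] by simp
  have S: "S \<in> measurable ?N ?N"
    unfolding S_def
    by (intro measurable_restrict measurable_component_singleton) (auto simp: sh_def I_def)
  have G': "G \<in> borel_measurable ?N" using G by (simp add: I_def)
  have "expectation (\<lambda>\<omega>. G (S (X \<omega>))) = (\<integral>x. G x \<partial>distr (distr M ?N X) ?N S)"
    using X S G' by (simp add: integral_distr distr_distr)
  also have "\<dots> = expectation (\<lambda>\<omega>. G (X \<omega>))"
    unfolding inv using X G' by (simp add: integral_distr)
  finally have "expectation (\<lambda>\<omega>. G (S (X \<omega>))) = expectation (\<lambda>\<omega>. G (X \<omega>))" .
  moreover have "S (X \<omega>) = (\<lambda>(k, j)\<in>I. a k (j + m) \<omega>)" for \<omega>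
    by (auto simp: S_def X_def sh_def I_def fun_eq_iff restrict_def)
  ultimately show ?thesis by (simp add: X_def I_def)
qed

lemma (in prob_space) expectation_iterate_translate:
  fixes a :: "nat \<Rightarrow> int \<Rightarrow> 'a \<Rightarrow> complex"
  assumes a: "\<And>k j. k \<le> p \<Longrightarrow> a k j \<in> borel_measurable M"
    and dist: "\<And>k j. k \<le> p \<Longrightarrow> distr M borel (a k j) = \<mu> k"
    and ind: "indep_vars (\<lambda>_. borel) (\<lambda>(k, j). a k j) ({..p} \<times> UNIV)"
  shows "expectation (\<lambda>\<omega>. (band_op p (\<lambda>k j. a k j \<omega>) ^^ s) (l2_basis m) m)
    = expectation (\<lambda>\<omega>. (band_op p (\<lambda>k j. a k j \<omega>) ^^ s) (l2_basis 0) 0)"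
proof -
  define G where "G f = (band_op p (\<lambda>k j. f (k, j)) ^^ s) (l2_basis 0) 0" for f
  have G: "G \<in> borel_measurable (\<Pi>\<^sub>M i\<in>{..p} \<times> UNIV. borel)"
    unfolding G_def by (rule iterate_measurable) (auto intro!: measurable_component_singleton)
  have eq: "G (\<lambda>(k, j)\<in>{..p} \<times> UNIV. a k (j + n) \<omega>)
      = (band_op p (\<lambda>k j. a k j \<omega>) ^^ s) (l2_basis n) n" for n \<omega>
  proof -
    have "band_op p (\<lambda>k j. (\<lambda>(k, j)\<in>{..p} \<times> UNIV. a k (j + n) \<omega>) (k, j))
        = band_op p (\<lambda>k j. a k (j + n) \<omega>)"
      by (rule band_op_cong) simp
    thus ?thesis
      unfolding G_def using iterate_translate[where a = "\<lambda>k j. a k j \<omega>" and m = n and j = 0 and i = 0] by simp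
  qed
  show ?thesis
    using iid_family_translation_invariant[OF a dist ind G, of m] eq[of m] eq[of 0] by simp
qed

text \<open>The sum of the full-operator diagonal entries over the window has expectation exactly \<open>n\<close> times
  that of the entry at \<open>0\<close>, and the trace of the truncation differs from this sum by a bounded
  amount.
\<close>

lemma (in prob_space) expected_trace_limit:
  fixes a :: "nat \<Rightarrow> int \<Rightarrow> 'a \<Rightarrow> complex"
  assumes a: "\<And>k j. k \<le> p \<Longrightarrow> a k j \<in> borel_measurable M"
    and dist: "\<And>k j. k \<le> p \<Longrightarrow> distr M borel (a k j) = \<mu> k"
    and ind: "indep_vars (\<lambda>_. borel) (\<lambda>(k, j). a k j) ({..p} \<times> UNIV)"
    and bounded: "\<And>\<omega>. \<omega> \<in> space M \<Longrightarrow> bounded_band p (\<lambda>k j. a k j \<omega>) C"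
  shows "\<And>n. integrable M (\<lambda>\<omega>. mat_trace (band_trunc p (\<lambda>k j. a k j \<omega>) n ^\<^sub>m s))"
    and "integrable M (\<lambda>\<omega>. (band_op p (\<lambda>k j. a k j \<omega>) ^^ s) (l2_basis 0) 0)"
    and "(\<lambda>n. 1 / of_nat n * expectation (\<lambda>\<omega>. mat_trace (band_trunc p (\<lambda>k j. a k j \<omega>) n ^\<^sub>m s)))
      \<longlonglongrightarrow> expectation (\<lambda>\<omega>. (band_op p (\<lambda>k j. a k j \<omega>) ^^ s) (l2_basis 0) 0)"
proof -
  let ?t = "\<lambda>n \<omega>. mat_trace (band_trunc p (\<lambda>k j. a k j \<omega>) n ^\<^sub>m s)"
  let ?d = "\<lambda>m \<omega>. (band_op p (\<lambda>k j. a k j \<omega>) ^^ s) (l2_basis m) m"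
  define K where "K = real (s + p * s) * (2 * band_bound p C ^ s)"
  show t: "integrable M (?t n)" for n
  proof (rule integrable_const_bound[where B = "real n * band_bound p C ^ s"])
    show "?t n \<in> borel_measurable M"
      unfolding mat_trace_band_trunc
      by (intro borel_measurable_sum band_trunc_pow_measurable a) auto
    show "AE \<omega> in M. norm (?t n \<omega>) \<le> real n * band_bound p C ^ s"
      by (intro AE_I2 bounded_band.mat_trace_band_trunc_le bounded)
  qed
  have d: "integrable M (?d m)" for m
    by (rule integrable_const_bound[where B = "band_bound p C ^ s"])
      (auto intro!: iterate_measurable a bounded_band.iterate_basis_le bounded)
  show "integrable M (?d 0)" by (rule d)
  let ?S = "\<lambda>n \<omega>. \<Sum>i<n. ?d (window_start n + int i) \<omega>"
  have S: "integrable M (?S n)" for n by (intro Bochner_Integration.integrable_sum d)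
  have ES: "expectation (?S n) = of_nat n * expectation (?d 0)" for n
  proof -
    have "expectation (?S n) = (\<Sum>i<n. expectation (?d (window_start n + int i)))"
      by (rule Bochner_Integration.integral_sum[OF d])
    also have "\<dots> = (\<Sum>i<n. expectation (?d 0))"
      by (intro sum.cong refl expectation_iterate_translate[OF a dist ind])
    finally show ?thesis by simp
  qed
  have close: "cmod (expectation (?t n) - of_nat n * expectation (?d 0)) \<le> K" for n
  proof -
    have eq: "expectation (?t n) - of_nat n * expectation (?d 0) = expectation (\<lambda>\<omega>. ?t n \<omega> - ?S n \<omega>)"
      unfolding ES[symmetric] by (rule Bochner_Integration.integral_diff[symmetric, OF t S])
    have "cmod (expectation (\<lambda>\<omega>. ?t n \<omega> - ?S n \<omega>)) \<le> expectation (\<lambda>\<omega>. cmod (?t n \<omega> - ?S n \<omega>))"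
      by (rule integral_norm_bound)
    also have "\<dots> \<le> expectation (\<lambda>\<omega>. K)"
      unfolding K_def
      by (intro integral_mono integrable_norm Bochner_Integration.integrable_diff t S
          bounded_band.mat_trace_band_trunc_approx bounded) auto
    finally show ?thesis unfolding eq using prob_space by simp
  qed
  have "cmod (1 / of_nat n * expectation (?t n) - expectation (?d 0)) \<le> K * (1 / real n)"
    if "n > 0" for n
  proof -
    have eq: "1 / of_nat n * expectation (?t n) - expectation (?d 0)
        = (expectation (?t n) - of_nat n * expectation (?d 0)) / of_nat n"
      using that by (simp add: field_simps)
    show ?thesis
      unfolding eq norm_divide norm_of_nat using divide_right_mono[OF close[of n], of "real n"] by simp
  qed
  hence "\<forall>\<^sub>F n in sequentially.
      norm (1 / of_nat n * expectation (?t n) - expectation (?d 0)) \<le> K * (1 / real n)"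
    by (intro eventually_sequentiallyI[of 1]) simp
  moreover have "(\<lambda>n. K * (1 / real n)) \<longlonglongrightarrow> 0"
    using tendsto_mult_left[OF lim_1_over_n, of K] by simp
  ultimately have "(\<lambda>n. 1 / of_nat n * expectation (?t n) - expectation (?d 0)) \<longlonglongrightarrow> 0"
    by (rule Lim_null_comparison)
  thus "(\<lambda>n. 1 / of_nat n * expectation (?t n)) \<longlonglongrightarrow> expectation (?d 0)"
    by (rule LIM_zero_cancel)
qed

theorem theorem5p1:
  fixes P :: "'w measure"
    and p :: nat
    and \<mu> :: "nat \<Rightarrow> complex measure"
    and a :: "nat \<Rightarrow> int \<Rightarrow> 'w \<Rightarrow> complex"
    and C :: real
  assumes "prob_space P"
    and "p \<ge> 1"
    and "\<And>k. k \<le> p \<Longrightarrow> prob_space (\<mu> k) \<and> sets (\<mu> k) = sets borel \<and> compact (msupport (\<mu> k))"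
    and "\<And>k j. k \<le> p \<Longrightarrow> a k j \<in> borel_measurable P"
    and "\<And>k. k \<le> p \<Longrightarrow> prob_space.indep_vars P (\<lambda>_. borel) (\<lambda>j. a k j) UNIV"
    and "\<And>k j. k \<le> p \<Longrightarrow> distr P borel (a k j) = \<mu> k"
    and "prob_space.indep_vars P (\<lambda>_. borel) (\<lambda>(k, j). a k j) ({..p} \<times> UNIV)"
    and "C > 0"
    and "\<And>k j \<omega>. k \<le> p \<Longrightarrow> \<omega> \<in> space P \<Longrightarrow> cmod (a k j \<omega>) \<le> C"
  shows
    "(\<forall>\<omega>\<in>space P. \<exists>c. is_laurent_at_infinity (resolvent_fun p (\<lambda>k j. a k j \<omega>)) c)
     \<and>
     (\<forall>s::nat.
        (\<forall>n. integrable P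
               (\<lambda>\<omega>. \<Sum>\<nu>\<in>#eigenvalues_mset (band_trunc p (\<lambda>k j. a k j \<omega>) n). \<nu> ^ s))
      \<and> integrable P (\<lambda>\<omega>. laurent_coeff (resolvent_fun p (\<lambda>k j. a k j \<omega>)) (int s + 1))
      \<and> (\<lambda>n. 1 / of_nat n *
              (\<integral>\<omega>. (\<Sum>\<nu>\<in>#eigenvalues_mset (band_trunc p (\<lambda>k j. a k j \<omega>) n). \<nu> ^ s) \<partial>P))
          \<longlonglongrightarrow> (\<integral>\<omega>. laurent_coeff (resolvent_fun p (\<lambda>k j. a k j \<omega>)) (int s + 1) \<partial>P))
     \<and>
     (\<exists>R>0. \<forall>z. cmod z > R \<longrightarrow>
        (\<forall>\<omega>\<in>space P. bij_betw (shifted_op p (\<lambda>k j. a k j \<omega>) z) l2 l2)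
      \<and> (\<forall>n. \<forall>\<omega>\<in>space P. band_char p (\<lambda>k j. a k j \<omega>) n z \<noteq> 0)
      \<and> (\<forall>n. integrable P
               (\<lambda>\<omega>. deriv (band_char p (\<lambda>k j. a k j \<omega>) n) z / band_char p (\<lambda>k j. a k j \<omega>) n z))
      \<and> integrable P (\<lambda>\<omega>. resolvent_fun p (\<lambda>k j. a k j \<omega>) z)
      \<and> (\<lambda>n. 1 / of_nat n *
              (\<integral>\<omega>. deriv (band_char p (\<lambda>k j. a k j \<omega>) n) z
                    / band_char p (\<lambda>k j. a k j \<omega>) n z \<partial>P))
          \<longlonglongrightarrow> (\<integral>\<omega>. resolvent_fun p (\<lambda>k j. a k j \<omega>) z \<partial>P))"
proof -
  interpret prob_space P by fact
  let ?a = "\<lambda>\<omega> k j. a k j \<omega>"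
  define B where "B = band_bound p C"
  have bounded: "bounded_band p (?a \<omega>) C" if "\<omega> \<in> space P" for \<omega>
    using assms(8) assms(9)[OF _ that] by unfold_locales auto
  let ?t = "\<lambda>n s \<omega>. mat_trace (band_trunc p (?a \<omega>) n ^\<^sub>m s)"
  let ?d = "\<lambda>s \<omega>. (band_op p (?a \<omega>) ^^ s) (l2_basis 0) 0"
  note limit = expected_trace_limit[OF assms(4) assms(6) assms(7) bounded]
  have t_meas: "?t n s \<in> borel_measurable P" and d_meas: "?d s \<in> borel_measurable P" for n s
    using limit(1,2) by (auto dest: borel_measurable_integrable)
  have t_le: "cmod (?t n s \<omega>) \<le> real n * B ^ s" and d_le: "cmod (?d s \<omega>) \<le> 1 * B ^ s"
    if "\<omega> \<in> space P" for n s \<omega>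
    using bounded_band.mat_trace_band_trunc_le[OF bounded[OF that]]
      bounded_band.iterate_basis_le[OF bounded[OF that]] by (simp_all add: B_def)
  have B: "0 < B" using assms(8) by (simp add: B_def band_bound_def add_pos_nonneg)
  have coeff: "laurent_coeff (resolvent_fun p (?a \<omega>)) (int s + 1) = ?d s \<omega>" if "\<omega> \<in> space P" for \<omega> s
    by (rule bounded_band.laurent_coeff_resolvent[OF bounded[OF that]])
  have power_sums: "(\<Sum>\<nu>\<in>#eigenvalues_mset (band_trunc p (?a \<omega>) n). \<nu> ^ s) = ?t n s \<omega>" for \<omega> n s
    by (rule eigenvalue_power_sum_eq_trace[OF band_trunc_carrier])

  have part1: "\<forall>\<omega>\<in>space P. \<exists>c. is_laurent_at_infinity (resolvent_fun p (?a \<omega>)) c"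
    using bounded_band.is_laurent_resolvent[OF bounded] by blast

  have part2: "(\<forall>n. integrable P (\<lambda>\<omega>. \<Sum>\<nu>\<in>#eigenvalues_mset (band_trunc p (?a \<omega>) n). \<nu> ^ s))
      \<and> integrable P (\<lambda>\<omega>. laurent_coeff (resolvent_fun p (?a \<omega>)) (int s + 1))
      \<and> (\<lambda>n. 1 / of_nat n * (\<integral>\<omega>. (\<Sum>\<nu>\<in>#eigenvalues_mset (band_trunc p (?a \<omega>) n). \<nu> ^ s) \<partial>P))
          \<longlonglongrightarrow> (\<integral>\<omega>. laurent_coeff (resolvent_fun p (?a \<omega>)) (int s + 1) \<partial>P)" for s
    using limit[where s = s] unfolding power_sums
    by (simp add: coeff cong: Bochner_Integration.integrable_cong Bochner_Integration.integral_cong)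

  have part3: "(\<forall>\<omega>\<in>space P. bij_betw (shifted_op p (?a \<omega>) z) l2 l2)
      \<and> (\<forall>n. \<forall>\<omega>\<in>space P. band_char p (?a \<omega>) n z \<noteq> 0)
      \<and> (\<forall>n. integrable P (\<lambda>\<omega>. deriv (band_char p (?a \<omega>) n) z / band_char p (?a \<omega>) n z))
      \<and> integrable P (\<lambda>\<omega>. resolvent_fun p (?a \<omega>) z)
      \<and> (\<lambda>n. 1 / of_nat n *
              (\<integral>\<omega>. deriv (band_char p (?a \<omega>) n) z / band_char p (?a \<omega>) n z \<partial>P))
          \<longlonglongrightarrow> (\<integral>\<omega>. resolvent_fun p (?a \<omega>) z \<partial>P)" if z: "B < cmod z" for z
  proof -
    have z': "band_bound p C < cmod z" using z by (simp add: B_def)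
    have resolvent: "resolvent_fun p (?a \<omega>) z = (\<Sum>s. ?d s \<omega> / z ^ (s + 1))" if "\<omega> \<in> space P" for \<omega>
      by (rule bounded_band.resolvent_fun_eq[OF bounded[OF that] z'])
    have log_deriv: "band_char p (?a \<omega>) n z \<noteq> 0"
      "deriv (band_char p (?a \<omega>) n) z / band_char p (?a \<omega>) n z = (\<Sum>s. ?t n s \<omega> / z ^ (s + 1))"
      if "\<omega> \<in> space P" for \<omega> n
      using log_deriv_char_poly_sums[OF band_trunc_carrier
          bounded_band.band_trunc_row_sum[OF bounded[OF that]] z']
      unfolding band_char_def[abs_def] by (auto simp: sums_iff)
    note series_t = expectation_power_series[OF t_meas t_le less_imp_le[OF B] z]
    note series_d = expectation_power_series[OF d_meas d_le less_imp_le[OF B] z]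
    have E_t: "expectation (\<lambda>\<omega>. deriv (band_char p (?a \<omega>) n) z / band_char p (?a \<omega>) n z)
        = (\<Sum>s. expectation (?t n s) / z ^ (s + 1))" for n
      using sums_unique[OF series_t(2)[of n]]
      by (simp add: log_deriv cong: Bochner_Integration.integral_cong del: power_Suc)
    have E_d: "expectation (\<lambda>\<omega>. resolvent_fun p (?a \<omega>) z) = (\<Sum>s. expectation (?d s) / z ^ (s + 1))"
      using sums_unique[OF series_d(2)]
      by (simp add: resolvent cong: Bochner_Integration.integral_cong del: power_Suc)
    \<comment> \<open>The traces grow at most like \<open>n * B ^ s\<close>, so after division by \<open>n\<close> one geometric series dominates
      for all \<open>n\<close> and the limit may be taken in each term; at \<open>n = 0\<close> the factor \<open>1 / n\<close> is \<open>0\<close>.\<close>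
    have "(\<lambda>n. \<Sum>s. 1 / of_nat n * expectation (?t n s) / z ^ (s + 1))
        \<longlonglongrightarrow> (\<Sum>s. expectation (?d s) / z ^ (s + 1))"
    proof (rule tannerys_theorem[THEN conjunct2, THEN conjunct2])
      show "(\<lambda>n. 1 / of_nat n * expectation (?t n s) / z ^ (s + 1))
          \<longlonglongrightarrow> expectation (?d s) / z ^ (s + 1)" for s
        by (intro tendsto_divide limit(3) tendsto_const) (use z B in auto)
      show "summable (\<lambda>s. 1 * B ^ s / cmod z ^ (s + 1))"
        by (rule summable_geometric_majorant[OF less_imp_le[OF B] z])
      have "cmod (1 / of_nat n * expectation (?t n s) / z ^ (s + 1)) \<le> 1 * B ^ s / cmod z ^ (s + 1)" for n s
      proof -
        have "cmod (expectation (?t n s)) \<le> expectation (\<lambda>\<omega>. cmod (?t n s \<omega>))"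
          by (rule integral_norm_bound)
        also have "\<dots> \<le> expectation (\<lambda>\<omega>. real n * B ^ s)"
          by (intro integral_mono integrable_norm limit(1) t_le) auto
        finally have "cmod (expectation (?t n s)) \<le> real n * B ^ s" using prob_space by simp
        hence "cmod (1 / of_nat n * expectation (?t n s)) \<le> 1 * B ^ s"
          using B by (cases "n = 0") (auto simp: norm_mult norm_divide field_simps)
        thus ?thesis
          unfolding norm_divide[of _ "z ^ (s + 1)"] norm_power by (rule divide_right_mono) simp
      qed
      thus "\<forall>\<^sub>F (s, n) in sequentially \<times>\<^sub>F sequentially.
          norm (1 / of_nat n * expectation (?t n s) / z ^ (s + 1)) \<le> 1 * B ^ s / cmod z ^ (s + 1)"
        by (intro always_eventually) auto
    qed simp
    moreover have "(\<Sum>s. 1 / of_nat n * expectation (?t n s) / z ^ (s + 1))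
        = 1 / of_nat n * (\<Sum>s. expectation (?t n s) / z ^ (s + 1))" for n
      using suminf_mult[OF sums_summable[OF series_t(2)[of n]], of "1 / of_nat n"] by simp
    ultimately have "(\<lambda>n. 1 / of_nat n *
          expectation (\<lambda>\<omega>. deriv (band_char p (?a \<omega>) n) z / band_char p (?a \<omega>) n z))
        \<longlonglongrightarrow> expectation (\<lambda>\<omega>. resolvent_fun p (?a \<omega>) z)"
      unfolding E_t E_d by simp
    moreover have "integrable P (\<lambda>\<omega>. deriv (band_char p (?a \<omega>) n) z / band_char p (?a \<omega>) n z)" for n
      using series_t(1)[of n]
      by (simp add: log_deriv cong: Bochner_Integration.integrable_cong del: power_Suc)
    moreover have "integrable P (\<lambda>\<omega>. resolvent_fun p (?a \<omega>) z)"
      using series_d(1)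
      by (simp add: resolvent cong: Bochner_Integration.integrable_cong del: power_Suc)
    ultimately show ?thesis
      using bounded_band.shifted_op_bij[OF bounded z'] log_deriv(1) by blast
  qed
  from part1 part2 part3 B show ?thesis by blast
qed

end
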